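(* Assume $\lambda(N)/N\to\lambda<1$ as $N\to\infty$. For the JSQ$(d(N))$ scheme let $\pi^{d(N)}$ be the stationary measure of the fluid-scaled occupancy state of the $N$-th system. If $d(N)\to\infty$ as $N\to\infty$, then $\pi^{d(N)}$ converges weakly, as $N\to\infty$, to $\pi^\star=\delta_{\mathbf{q}^\star}$, the Dirac measure concentrated at $\mathbf{q}^\star=(q_1^\star,\dots,q_b^\star)$, where $q_1^\star=\lambda$ and $q_i^\star=0$ for $i=2,\dots,b$.
   Context: Model: the $N$-th system has $N$ parallel identical single-server queues and one dispatcher. Tasks with independent unit-mean exponential service requirements arrive as a Poisson process of rate $\lambda(N)$. On arrival, a task is immediately assigned to a server with the shortest queue among $d(N)$ servers selected uniformly at random (without replacement), $1\le d(N)\le N$ (the JSQ$(d(N))$ scheme). Each server has buffer capacity $b$ ($1\le b\le\infty$, including the task in service); a task assigned to a server with $b$ pending tasks is permanently discarded. $Q_i^{d(N)}(t)$ is the number of servers with queue length at least $i$ (including the task in service) at time $t$, $i=1,\dots,b$, and $\mathbf{q}^{d(N)}(t)=(Q_i^{d(N)}(t)/N)_{1\le i\le b}$ is the fluid-scaled occupancy state, taking values in $\mathcal{S}=\{\mathbf{q}\in[0,1]^b: q_i\le q_{i-1}\text{ for } i=2,\dots,b,\ \sum_{i=1}^b q_i<\infty\}$, equipped with the $\ell_1$ topology ("$i=1,\dots,b$" means all $i\ge1$ when $b=\infty$). The stationary measure is $\pi^{d(N)}(\cdot)=\lim_{t\to\infty}\mathbb{P}(\mathbf{q}^{d(N)}(t)=\cdot)$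 (defined for all $N$ large enough that it exists). *)

theory Defs
  imports "HOL-Probability.Probability"
begin

section \<open>Continuous-time Markov chains on a countable state space\<close>

text \<open>
  A family of transition probabilities on \<open>S\<close> (a Markov semigroup) whose matrix of derivatives
  at time 0 is \<open>G\<close>. The off-diagonal entries of \<open>G\<close> are the transition rates.
\<close>

definition markov_semigroup ::
    "'a set \<Rightarrow> ('a \<Rightarrow> 'a \<Rightarrow> real) \<Rightarrow> (real \<Rightarrow> 'a \<Rightarrow> 'a pmf) \<Rightarrow> bool" where
  "markov_semigroup S G P \<longleftrightarrow>
     (\<forall>x\<in>S. P 0 x = return_pmf x) \<and>
     (\<forall>x\<in>S. \<forall>t\<ge>0. set_pmf (P t x) \<subseteq> S) \<and>
     (\<forall>x\<in>S. \<forall>s\<ge>0. \<forall>t\<ge>0. P (s + t) x = bind_pmf (P s x) (P t)) \<and>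
     (\<forall>x\<in>S. \<forall>y\<in>S. ((\<lambda>t. pmf (P t x) y) has_real_derivative G x y) (at 0 within {0..}))"

text \<open>
  \<open>X\<close> is a right-continuous Markov process on \<open>S\<close> with rate matrix \<open>G\<close> and an arbitrary
  initial distribution. The times in the finite set \<open>F\<close> make up the past before \<open>t\<close>.
\<close>

definition is_ctmc ::
    "'w measure \<Rightarrow> (real \<Rightarrow> 'w \<Rightarrow> 'a) \<Rightarrow> 'a set \<Rightarrow> ('a \<Rightarrow> 'a \<Rightarrow> real) \<Rightarrow> bool" where
  "is_ctmc M X S G \<longleftrightarrow>
     prob_space M \<and>
     (\<forall>t\<ge>0. X t \<in> measurable M (count_space S)) \<and>
     (\<forall>\<omega>\<in>space M. \<forall>t\<ge>0. \<forall>\<^sub>F u in at_right t. X u \<omega> = X t \<omega>) \<and>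
     (\<exists>P. markov_semigroup S G P \<and>
        (\<forall>t\<ge>0. \<forall>s\<ge>0. \<forall>F z. \<forall>x\<in>S. \<forall>y\<in>S. finite F \<longrightarrow> F \<subseteq> {0..t} \<longrightarrow>
           measure M {\<omega>\<in>space M. (\<forall>u\<in>F. X u \<omega> = z u) \<and> X t \<omega> = x \<and> X (t + s) \<omega> = y} =
           measure M {\<omega>\<in>space M. (\<forall>u\<in>F. X u \<omega> = z u) \<and> X t \<omega> = x} * pmf (P s x) y))"


section \<open>The JSQ(d) scheme\<close>

text \<open>
  The state of the system with \<open>N\<close> servers is the list of the \<open>N\<close> queue lengths
  (tasks in service included).
\<close>

definition queue_states :: "nat \<Rightarrow> enat \<Rightarrow> nat list set" where
  "queue_states N b = {x. length x = N \<and> (\<forall>k<N. enat (x ! k) \<le> b)}"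

definition server_samples :: "nat \<Rightarrow> nat \<Rightarrow> nat set set" where
  "server_samples N d = {D. D \<subseteq> {..<N} \<and> card D = d}"

definition shortest :: "nat list \<Rightarrow> nat set \<Rightarrow> nat set" where
  "shortest x D = {k\<in>D. \<forall>j\<in>D. x ! k \<le> x ! j}"

text \<open>
  The scheme leaves open how ties are broken: \<open>tie x D\<close> is an arbitrary, possibly
  randomized, choice among the shortest queues in the sample \<open>D\<close>.
\<close>

definition tie_breaking ::
    "nat \<Rightarrow> enat \<Rightarrow> nat \<Rightarrow> (nat list \<Rightarrow> nat set \<Rightarrow> nat pmf) \<Rightarrow> bool" where
  "tie_breaking N b d tie \<longleftrightarrow>
     (\<forall>x\<in>queue_states N b. \<forall>D\<in>server_samples N d. set_pmf (tie x D) \<subseteq> shortest x D)"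

definition after_arrival ::
    "nat \<Rightarrow> enat \<Rightarrow> nat \<Rightarrow> (nat list \<Rightarrow> nat set \<Rightarrow> nat pmf) \<Rightarrow> nat list \<Rightarrow> nat list pmf" where
  "after_arrival N b d tie x =
     bind_pmf (pmf_of_set (server_samples N d)) (\<lambda>D.
     bind_pmf (tie x D) (\<lambda>k.
     return_pmf (if enat (x ! k) < b then x[k := x ! k + 1] else x)))"

text \<open>
  Arrivals occur at rate \<open>l\<close> (Poisson arrivals), and each busy server completes a task at rate 1
  (independent exponential service requirements of unit mean). Subtracting \<open>of_bool (x = y)\<close>
  yields the diagonal of the rate matrix; a discarded task contributes nothing.
\<close>

definition jsq_rates ::
    "nat \<Rightarrow> enat \<Rightarrow> nat \<Rightarrow> (nat list \<Rightarrow> nat set \<Rightarrow> nat pmf) \<Rightarrow> real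
      \<Rightarrow> nat list \<Rightarrow> nat list \<Rightarrow> real" where
  "jsq_rates N b d tie l x y =
     l * (pmf (after_arrival N b d tie x) y - of_bool (x = y)) +
     (\<Sum>k | k < N \<and> 0 < x ! k. of_bool (x[k := x ! k - 1] = y) - of_bool (x = y))"

definition jsq_system ::
    "nat \<Rightarrow> enat \<Rightarrow> nat \<Rightarrow> (nat list \<Rightarrow> nat set \<Rightarrow> nat pmf) \<Rightarrow> real
      \<Rightarrow> 'w measure \<Rightarrow> (real \<Rightarrow> 'w \<Rightarrow> nat list) \<Rightarrow> bool" where
  "jsq_system N b d tie l M X \<longleftrightarrow>
     tie_breaking N b d tie \<and> is_ctmc M X (queue_states N b) (jsq_rates N b d tie l)"


section \<open>The fluid-scaled occupancy state\<close>

text \<open>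
  A vector \<open>(q i)\<close>, \<open>1 \<le> i \<le> b\<close> with \<open>b \<le> \<infinity>\<close>, is a function on \<open>nat\<close> that vanishes at all
  other indices, in particular at \<open>0\<close>.
\<close>

definition levels :: "enat \<Rightarrow> nat set" where
  "levels b = {i. 1 \<le> i \<and> enat i \<le> b}"

definition occupancy :: "nat \<Rightarrow> enat \<Rightarrow> nat list \<Rightarrow> nat \<Rightarrow> real" where
  "occupancy N b x i =
     (if i \<in> levels b then real (card {k. k < N \<and> i \<le> x ! k}) / real N else 0)"

definition occ_space :: "enat \<Rightarrow> (nat \<Rightarrow> real) set" where
  "occ_space b = {q. (\<forall>i\<in>levels b. 0 \<le> q i \<and> q i \<le> 1) \<and> (\<forall>i. i \<notin> levels b \<longrightarrow> q i = 0) \<and>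
     (\<forall>i\<in>levels b. 2 \<le> i \<longrightarrow> q i \<le> q (i - 1)) \<and> q summable_on UNIV}"

definition l1_dist :: "(nat \<Rightarrow> real) \<Rightarrow> (nat \<Rightarrow> real) \<Rightarrow> real" where
  "l1_dist p q = (\<Sum>\<^sub>\<infinity>i. \<bar>p i - q i\<bar>)"

definition occ_topology :: "enat \<Rightarrow> (nat \<Rightarrow> real) topology" where
  "occ_topology b = Metric_space.mtopology (occ_space b) l1_dist"

definition borel_on :: "'a topology \<Rightarrow> 'a measure" where
  "borel_on T = sigma (topspace T) {U. openin T U}"

definition weakly_converges :: "'a topology \<Rightarrow> (nat \<Rightarrow> 'a measure) \<Rightarrow> 'a measure \<Rightarrow> bool" where
  "weakly_converges T \<mu> \<nu> \<longleftrightarrow>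
     (\<forall>f::'a \<Rightarrow> real. continuous_map T euclideanreal f \<longrightarrow> bounded (f ` topspace T) \<longrightarrow>
        (\<lambda>n. integral\<^sup>L (\<mu> n) f) \<longlonglongrightarrow> integral\<^sup>L \<nu> f)"

text \<open>
  \<open>\<pi> {q}\<close> is the limit of the probability that the occupancy state at time \<open>t\<close> equals \<open>q\<close>.
  The countable set of occupancy states of the \<open>N\<close>-th system must carry the full mass, so that
  these limits determine \<open>\<pi>\<close> and no mass escapes to infinity.
\<close>

definition is_stationary_measure ::
    "nat \<Rightarrow> enat \<Rightarrow> 'w measure \<Rightarrow> (real \<Rightarrow> 'w \<Rightarrow> nat list) \<Rightarrow> (nat \<Rightarrow> real) measure \<Rightarrow> bool" where
  "is_stationary_measure N b M X \<pi> \<longleftrightarrow>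
     prob_space \<pi> \<and> sets \<pi> = sets (borel_on (occ_topology b)) \<and>
     measure \<pi> (occupancy N b ` queue_states N b) = 1 \<and>
     (\<forall>q\<in>occ_space b.
        ((\<lambda>t. measure M {\<omega>\<in>space M. occupancy N b (X t \<omega>) = q}) \<longlongrightarrow> measure \<pi> {q}) at_top)"

definition q_star :: "real \<Rightarrow> nat \<Rightarrow> real" where
  "q_star l i = (if i = 1 then l else 0)"


section \<open>Well-definedness\<close>

lemma occ_space_diff_summable:
  assumes "p \<in> occ_space b" "q \<in> occ_space b"
  shows "(\<lambda>i. \<bar>p i - q i\<bar>) summable_on UNIV"
proof (rule summable_on_comparison_test)
  show "(\<lambda>i. p i + q i) summable_on UNIV"
    using assms by (auto simp: occ_space_def intro: summable_on_add)
  fix i show "\<bar>p i - q i\<bar> \<le> p i + q i"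
    using assms by (cases "i \<in> levels b") (auto simp: occ_space_def abs_le_iff)
qed auto

lemma Metric_space_occ: "Metric_space (occ_space b) l1_dist"
proof
  fix p q :: "nat \<Rightarrow> real"
  show "0 \<le> l1_dist p q"
    by (simp add: l1_dist_def infsum_nonneg)
  show "l1_dist p q = l1_dist q p"
    by (simp add: l1_dist_def abs_minus_commute)
next
  fix p q assume *: "p \<in> occ_space b" "q \<in> occ_space b"
  show "l1_dist p q = 0 \<longleftrightarrow> p = q"
  proof
    assume "l1_dist p q = 0"
    then have "\<bar>p i - q i\<bar> = 0" for i
      using nonneg_infsum_le_0D[of "\<lambda>i. \<bar>p i - q i\<bar>" UNIV i] occ_space_diff_summable[OF *]
      by (simp add: l1_dist_def)
    then show "p = q" by auto
  qed (simp add: l1_dist_def)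
next
  fix p q r assume *: "p \<in> occ_space b" "q \<in> occ_space b" "r \<in> occ_space b"
  have "l1_dist p r \<le> (\<Sum>\<^sub>\<infinity>i. \<bar>p i - q i\<bar> + \<bar>q i - r i\<bar>)"
    unfolding l1_dist_def using *
    by (intro infsum_mono summable_on_add occ_space_diff_summable) auto
  also have "\<dots> = l1_dist p q + l1_dist q r"
    unfolding l1_dist_def using * by (intro infsum_add occ_space_diff_summable)
  finally show "l1_dist p r \<le> l1_dist p q + l1_dist q r" .
qed

lemma topspace_occ_topology [simp]: "topspace (occ_topology b) = occ_space b"
  by (simp add: occ_topology_def Metric_space.topspace_mtopology[OF Metric_space_occ])

lemma occupancy_in_occ_space:
  assumes "x \<in> queue_states N b"
  shows "occupancy N b x \<in> occ_space b"
proof -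
  have bound: "card {k. k < N \<and> i \<le> x ! k} \<le> N" for i
    using card_mono[of "{..<N}" "{k. k < N \<and> i \<le> x ! k}"] by auto
  have "card {k. k < N \<and> i \<le> x ! k} \<le> card {k. k < N \<and> i - 1 \<le> x ! k}" for i
    by (rule card_mono) auto
  moreover have "i - 1 \<in> levels b" if "i \<in> levels b" "2 \<le> i" for i
  proof -
    have "enat (i - 1) \<le> enat i" by simp
    also have "\<dots> \<le> b" using that(1) by (simp add: levels_def)
    finally show ?thesis using that(2) by (simp add: levels_def)
  qed
  moreover have "occupancy N b x summable_on UNIV"
  proof -
    have "occupancy N b x i = 0" if "i \<notin> {..sum ((!) x) {..<N}}" for i
    proof -
      have "x ! k < i" if "k < N" for k
        using member_le_sum[of k "{..<N}" "(!) x"] that \<open>i \<notin> _\<close> by auto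
      then have "{k. k < N \<and> i \<le> x ! k} = {}" by (auto simp: not_le)
      then show ?thesis unfolding occupancy_def by simp
    qed
    then show ?thesis
      using summable_on_cong_neutral[of UNIV "{..sum ((!) x) {..<N}}"
          "occupancy N b x" "occupancy N b x"] by auto
  qed
  ultimately show ?thesis
    using bound by (auto simp: occ_space_def occupancy_def divide_simps)
qed

lemma q_star_in_occ_space:
  assumes "1 \<le> b" "0 \<le> l" "l \<le> 1"
  shows "q_star l \<in> occ_space b"
proof -
  have "q_star l summable_on UNIV"
    using summable_on_cong_neutral[of UNIV "{1}" "q_star l" "q_star l"]
    by (auto simp: q_star_def)
  moreover have "(1::nat) \<in> levels b"
    using assms by (simp add: levels_def one_enat_def)
  ultimately show ?thesis
    using assms by (auto simp: occ_space_def q_star_def)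
qed

end

theory Submission
  imports Defs
begin

text \<open>
  Write \<open>q i\<close> for the fraction of servers with at least \<open>i\<close> tasks, and \<open>r = lam N / N\<close>. The proof
  does not pass through the fluid limit; it estimates moments of the stationary law directly.

  All transition rates of the system are bounded, so the expected rate of change of a bounded function
  of the state can be computed from the rate matrix. In equilibrium it vanishes, and an upper
  bound for it that depends on the occupancy state only has nonnegative stationary expectation
  (\<open>stationary_drift_nonneg\<close>). Two kinds of functions are used.

  The number of tasks at positions beyond \<open>a\<close> of the queues grows only when all \<open>d\<close> sampled
  servers have at least \<open>a\<close> tasks, which happens with probability at most \<open>q a ^ d\<close>, and decreases at
  rate \<open>N * q (a + 1)\<close>. Hence \<open>E (q (a + 1)) \<le> r * E (q a ^ d)\<close> with \<open>q 0 = 1\<close>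
  (\<open>expectation_Suc_le\<close>). In particular \<open>E (q i) \<le> r ^ i\<close>, which controls the
  tail of the sequence \<open>q\<close>, and \<open>E (q 2) \<le> r * E (q 1 ^ d)\<close>.

  The square of the idle fraction \<open>1 - q 1\<close> yields, up to terms of order \<open>1 / N\<close>,
  \<open>0 \<le> E ((1 - q 1) * (q 1 - r)) + r * E ((1 - q 1) * q 1 ^ d)\<close>. The first summand is
  \<open>(1 - r) * E (q 1 - r) - E ((q 1 - r)\<^sup>2)\<close>, where \<open>E (q 1 - r) \<le> 0\<close>, and in the second one
  \<open>(1 - u) * u ^ d \<le> 1 / (d + 1)\<close> for every \<open>u\<close> in the unit interval. Therefore the mean square deviation
  of \<open>q 1\<close> from \<open>r\<close> tends to 0 (\<open>busy_fraction_variance\<close>). As \<open>r\<close> stays away from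
  1, so does \<open>q 1\<close> with high probability; then \<open>E (q 1 ^ d)\<close> tends to 0, and so does \<open>E (q 2)\<close>.
  Together with the geometric decay of the levels this is convergence to the fixed point in mean
  \<open>l\<^sub>1\<close>-distance (\<open>stationary_deviation_tendsto_0\<close>), which implies weak convergence.
\<close>

section \<open>Preliminaries on monotonicity and expectations\<close>

text \<open>
  A mean value inequality for right increments: the points at which the bound holds form a closed
  set, and the hypothesis pushes its supremum past every point before \<open>b\<close>. Expectations along a
  Markov process are differentiable from the right by dominated convergence, so one-sided
  information is what is at hand.
\<close>

lemma growth_le_if_right_increments_le:
  fixes u :: "real \<Rightarrow> real"
  assumes cont: "continuous_on {a..b} u" and ab: "a \<le> b"
    and incr: "\<And>s. a \<le> s \<Longrightarrow> s < b \<Longrightarrow> \<forall>\<^sub>F h in at_right 0. u (s + h) - u s \<le> c * h"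
  shows "u b - u a \<le> c * (b - a)"
proof -
  define Z where "Z = {s \<in> {a..b}. u s \<le> u a + c * (s - a)}"
  have Z: "Sup Z \<in> Z"
  proof (rule closed_contains_Sup)
    show "closed Z" unfolding Z_def
      by (intro continuous_on_closed_Collect_le cont continuous_intros)
  qed (use ab in \<open>auto simp: Z_def bdd_above_def\<close>)
  have "Sup Z = b"
  proof (rule ccontr)
    let ?s = "Sup Z"
    assume "?s \<noteq> b"
    with Z have s: "a \<le> ?s" "?s < b" by (auto simp: Z_def)
    have "\<forall>\<^sub>F h in at_right 0. h < b - ?s"
      using s by (auto simp: eventually_at_right_field intro!: exI[of _ "b - ?s"])
    moreover have "\<forall>\<^sub>F h in at_right 0. (0::real) < h"
      by (simp add: eventually_at_right_less)
    ultimately have "\<forall>\<^sub>F h in at_right 0. u (?s + h) - u ?s \<le> c * h \<and> h < b - ?s \<and> 0 < h"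
      using incr[OF s] by eventually_elim auto
    then obtain h where h: "u (?s + h) - u ?s \<le> c * h" "h < b - ?s" "0 < h"
      using eventually_happens trivial_limit_at_right_real by blast
    have "?s + h \<in> Z" using Z h s by (auto simp: Z_def algebra_simps)
    then have "?s + h \<le> ?s" by (intro cSup_upper) (auto simp: Z_def bdd_above_def)
    with h show False by simp
  qed
  with Z show ?thesis by (auto simp: Z_def)
qed

lemma expectation_bind_pmf_bounded:
  fixes f :: "'a \<Rightarrow> real"
  assumes "\<And>y. \<bar>f y\<bar> \<le> B"
  shows "measure_pmf.expectation (bind_pmf p K) f =
         measure_pmf.expectation p (\<lambda>x. measure_pmf.expectation (K x) f)"
  unfolding measure_pmf_bind
  by (rule integral_bind[where K="count_space UNIV" and B=B and B'=1])
     (use assms measurable_measure_pmf[of K] in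
       \<open>auto intro!: measure_pmf.emeasure_le_1 measure_pmf.finite_measure_axioms\<close>)

lemma integrable_pmf_bounded:
  fixes f :: "'a \<Rightarrow> real"
  assumes "\<And>y. \<bar>f y\<bar> \<le> B"
  shows "integrable (measure_pmf p) f"
  by (rule measure_pmf.integrable_const_bound[where B=B]) (use assms in auto)

lemma abs_expectation_le:
  fixes f :: "'a \<Rightarrow> real"
  assumes "\<And>y. y \<in> set_pmf p \<Longrightarrow> \<bar>f y\<bar> \<le> B"
  shows "\<bar>measure_pmf.expectation p f\<bar> \<le> B"
proof -
  have i: "integrable (measure_pmf p) f"
    by (rule measure_pmf.integrable_const_bound[where B=B]) (use assms in \<open>auto simp: AE_measure_pmf_iff\<close>)
  have "measure_pmf.expectation p f \<le> B"
    by (rule measure_pmf.integral_le_const[OF i]) (use assms in \<open>force simp: AE_measure_pmf_iff\<close>)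
  moreover have "- B \<le> measure_pmf.expectation p f"
    by (rule measure_pmf.integral_ge_const[OF i]) (use assms in \<open>force simp: AE_measure_pmf_iff\<close>)
  ultimately show ?thesis by auto
qed

section \<open>Markov semigroups with bounded rates\<close>

text \<open>
  The uniform bound \<open>q\<close> on the exit rates is what makes all difference quotients at time 0
  bounded uniformly in the state, so that they can be integrated over any law of the process.
\<close>

locale bounded_rate_semigroup =
  fixes S :: "'a set" and G :: "'a \<Rightarrow> 'a \<Rightarrow> real" and P :: "real \<Rightarrow> 'a \<Rightarrow> 'a pmf" and q :: real
  assumes semigroup: "markov_semigroup S G P"
    and exit_rate: "\<And>x. x \<in> S \<Longrightarrow> - q \<le> G x x"
begin

lemma pmf_deriv:
  assumes "x \<in> S" "y \<in> S"
  shows "((\<lambda>h. (pmf (P h x) y - of_bool (x = y)) / h) \<longlongrightarrow> G x y) (at_right 0)"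
proof -
  have "((\<lambda>t. pmf (P t x) y) has_real_derivative G x y) (at 0 within {0..})"
    and 0: "P 0 x = return_pmf x"
    using semigroup assms by (auto simp: markov_semigroup_def)
  then have "((\<lambda>t. pmf (P t x) y) has_real_derivative G x y) (at 0 within {0<..})"
    by (rule_tac DERIV_subset[of _ _ _ "{0..}"]) auto
  then show ?thesis
    by (simp add: has_field_derivative_iff 0 pmf_return indicator_def of_bool_def eq_commute)
qed

lemma stay_probability_mult:
  assumes "x \<in> S" "s \<ge> 0" "t \<ge> 0"
  shows "pmf (P s x) x * pmf (P t x) x \<le> pmf (P (s + t) x) x"
proof -
  have "pmf (P (s + t) x) x = measure_pmf.expectation (P s x) (\<lambda>y. pmf (P t y) x)"
    using semigroup assms by (simp add: markov_semigroup_def pmf_bind)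
  also have "\<dots> \<ge> measure_pmf.expectation (P s x) (\<lambda>y. pmf (P t x) x * indicator {x} y)"
    by (intro integral_mono integrable_pmf_bounded[of _ 1])
       (auto simp: indicator_def pmf_le_1)
  finally show ?thesis by (simp add: measure_pmf_single mult.commute)
qed

lemma stay_probability_power:
  assumes "x \<in> S" "s \<ge> 0"
  shows "pmf (P s x) x ^ n \<le> pmf (P (real n * s) x) x"
proof (induction n)
  case 0
  have "P 0 x = return_pmf x" using semigroup assms by (auto simp: markov_semigroup_def)
  then show ?case by simp
next
  case (Suc n)
  have "pmf (P s x) x ^ Suc n \<le> pmf (P s x) x * pmf (P (real n * s) x) x"
    using Suc by (simp add: mult_left_mono)
  also have "\<dots> \<le> pmf (P (s + real n * s) x) x"
    using assms by (intro stay_probability_mult) auto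
  finally show ?case by (simp add: algebra_simps)
qed

text \<open>
  Staying put at \<open>n\<close> successive times a distance \<open>t / n\<close> apart is one way of being in \<open>x\<close>
  at time \<open>t\<close>. This gives a lower bound that depends on the derivative at 0 alone.
\<close>

lemma stay_probability_ge:
  assumes x: "x \<in> S" and t: "t \<ge> 0"
  shows "1 - q * t \<le> pmf (P t x) x"
proof (cases "t = 0")
  case True
  have "P 0 x = return_pmf x" using semigroup assms by (auto simp: markov_semigroup_def)
  with True show ?thesis by simp
next
  case False
  with t have t: "t > 0" by simp
  \<comment> \<open>Bernoulli over \<open>n + 1\<close> steps of length \<open>s n\<close>; the limit sees only the derivative at 0.\<close>
  define s where "s = (\<lambda>n. t / real (Suc n))"
  have lim: "filterlim s (at_right 0) sequentially"
    using t tendsto_mult_right_zero[OF LIMSEQ_inverse_real_of_nat, of t]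
    by (auto simp: filterlim_at s_def divide_inverse simp del: of_nat_Suc)
  have "(\<lambda>n. 1 + t * ((pmf (P (s n) x) x - of_bool (x = x)) / s n)) \<longlonglongrightarrow> 1 + t * G x x"
    by (intro tendsto_intros filterlim_compose[OF pmf_deriv lim] x)
  moreover have "1 + t * ((pmf (P (s n) x) x - of_bool (x = x)) / s n) \<le> pmf (P t x) x" for n
  proof -
    have s: "0 \<le> s n" using t by (simp add: s_def)
    have "1 + t * ((pmf (P (s n) x) x - of_bool (x = x)) / s n)
        = 1 + real (Suc n) * (pmf (P (s n) x) x - 1)"
      using t by (simp add: s_def field_simps)
    also have "\<dots> \<le> (1 + (pmf (P (s n) x) x - 1)) ^ Suc n"
      using pmf_nonneg[of "P (s n) x" x] by (intro Bernoulli_inequality) simp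
    also have "\<dots> \<le> pmf (P (real (Suc n) * s n) x) x"
      using stay_probability_power[OF x s, of "Suc n"] by simp
    finally show ?thesis by (simp add: s_def)
  qed
  ultimately have "1 + t * G x x \<le> pmf (P t x) x"
    by (intro LIMSEQ_le_const2) auto
  moreover have "- (q * t) \<le> t * G x x"
    using mult_left_mono[OF exit_rate[OF x], of t] t by (simp add: mult.commute)
  ultimately show ?thesis by simp
qed

text \<open>
  The value of \<open>f\<close> changes only if the process has left \<open>x\<close>, and then by at most \<open>2 * B\<close>.
\<close>

lemma expectation_increment_le:
  assumes x: "x \<in> S" and h: "h \<ge> 0" and f: "\<And>y. \<bar>f y\<bar> \<le> (B::real)"
  shows "\<bar>measure_pmf.expectation (P h x) f - f x\<bar> \<le> 2 * B * q * h"
proof -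
  have B: "0 \<le> B" using f[of x] by linarith
  have i: "integrable (P h x) f" using f by (rule integrable_pmf_bounded)
  have "measure_pmf.expectation (P h x) f - f x = measure_pmf.expectation (P h x) (\<lambda>y. f y - f x)"
    using i by simp
  also have "\<bar>\<dots>\<bar> \<le> measure_pmf.expectation (P h x) (\<lambda>y. \<bar>f y - f x\<bar>)"
    by (rule integral_abs_bound)
  also have "\<dots> \<le> measure_pmf.expectation (P h x) (\<lambda>y. 2 * B * (1 - indicator {x} y))"
  proof (intro integral_mono integrable_pmf_bounded[of _ "2 * B"])
    fix y show "\<bar>f y - f x\<bar> \<le> 2 * B * (1 - indicator {x} y)"
      using f[of x] f[of y] by (auto simp: indicator_def)
    show "\<bar>\<bar>f y - f x\<bar>\<bar> \<le> 2 * B" "\<bar>2 * B * (1 - indicator {x} y)\<bar> \<le> 2 * B"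
      using f[of x] f[of y] by (auto simp: indicator_def)
  qed
  also have "\<dots> = 2 * B * (1 - pmf (P h x) x)"
    by (simp add: measure_pmf_single integrable_pmf_bounded[of _ 1] )
  also have "\<dots> \<le> 2 * B * (q * h)"
    using stay_probability_ge[OF x h] B by (intro mult_left_mono) auto
  finally show ?thesis by (simp add: mult.assoc)
qed

text \<open>
  The mass inside \<open>K\<close> has derivative \<open>\<Sum>y\<in>K. G x y = 0\<close> at time 0. Hence the mass outside
  \<open>K\<close> is \<open>o(h)\<close>, and a bounded \<open>f\<close> does not feel it.
\<close>

lemma generator_tendsto:
  assumes f: "\<And>y. \<bar>f y\<bar> \<le> (B::real)"
    and K: "finite K" "K \<subseteq> S" "x \<in> K" "(\<Sum>y\<in>K. G x y) = 0"
  shows "((\<lambda>h. (measure_pmf.expectation (P h x) f - f x) / h) \<longlongrightarrow> (\<Sum>y\<in>K. G x y * f y)) (at_right 0)"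
proof -
  define D where "D h y = (pmf (P h x) y - of_bool (x = y)) / h" for h y
  have D: "((\<lambda>h. D h y) \<longlongrightarrow> G x y) (at_right 0)" if "y \<in> K" for y
    using pmf_deriv[of x y] K(2,3) that unfolding D_def by blast
  have B: "0 \<le> B" using f[of x] by linarith
  have "\<bar>(measure_pmf.expectation (P h x) f - f x) / h - (\<Sum>y\<in>K. D h y * f y)\<bar>
      \<le> - B * (\<Sum>y\<in>K. D h y)" if h: "h > 0" for h
  proof -
    have i: "integrable (P h x) f" using f by (rule integrable_pmf_bounded)
    have one: "(\<Sum>y\<in>K. of_bool (x = y) * g y) = g x" for g :: "'a \<Rightarrow> real"
      using K by (simp add: of_bool_def if_distrib[of "\<lambda>c. c * _"] cong: if_cong)
    have pK: "(\<Sum>y\<in>K. pmf (P h x) y) = measure_pmf.prob (P h x) K"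
      using K by (simp add: measure_measure_pmf_finite)
    have "measure_pmf.expectation (P h x) f - (\<Sum>y\<in>K. pmf (P h x) y * f y)
        = measure_pmf.expectation (P h x) (\<lambda>y. f y) - measure_pmf.expectation (P h x) (\<lambda>y. f y * indicator K y)"
      using K by (subst integral_measure_pmf_real[of K "P h x" "\<lambda>y. f y * indicator K y"])
        (auto simp: indicator_def mult.commute intro!: sum.cong split: if_splits)
    also have "\<dots> = measure_pmf.expectation (P h x) (\<lambda>y. f y * (1 - indicator K y))"
      using i integrable_pmf_bounded[of "\<lambda>y. f y * indicator K y" B "P h x"] f B
      by (simp add: right_diff_distrib indicator_def)
    also have "\<bar>\<dots>\<bar> \<le> measure_pmf.expectation (P h x) (\<lambda>y. \<bar>f y * (1 - indicator K y)\<bar>)"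
      by (rule integral_abs_bound)
    also have "\<dots> \<le> measure_pmf.expectation (P h x) (\<lambda>y. B * (1 - indicator K y))"
      by (intro integral_mono integrable_pmf_bounded[of _ B]) (auto simp: indicator_def f B)
    also have "\<dots> = B * (1 - (\<Sum>y\<in>K. pmf (P h x) y))"
      by (simp add: pK integrable_pmf_bounded[of _ 1])
    finally have *: "\<bar>measure_pmf.expectation (P h x) f - (\<Sum>y\<in>K. pmf (P h x) y * f y)\<bar>
        \<le> B * (1 - (\<Sum>y\<in>K. pmf (P h x) y))" .
    have "(\<Sum>y\<in>K. D h y * f y) = ((\<Sum>y\<in>K. pmf (P h x) y * f y) - f x) / h"
      by (simp add: D_def diff_divide_distrib left_diff_distrib sum_subtractf one
          flip: sum_divide_distrib)
    moreover have "(\<Sum>y\<in>K. D h y) = ((\<Sum>y\<in>K. pmf (P h x) y) - 1) / h"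
      using one[of "\<lambda>_. 1"] by (simp add: D_def diff_divide_distrib sum_subtractf flip: sum_divide_distrib)
    ultimately have "(measure_pmf.expectation (P h x) f - f x) / h - (\<Sum>y\<in>K. D h y * f y)
        = (measure_pmf.expectation (P h x) f - (\<Sum>y\<in>K. pmf (P h x) y * f y)) / h"
      and "- B * (\<Sum>y\<in>K. D h y) = B * (1 - (\<Sum>y\<in>K. pmf (P h x) y)) / h"
      by (simp_all add: diff_divide_distrib right_diff_distrib)
    with divide_right_mono[OF *, of h] h show ?thesis by (simp add: abs_divide)
  qed
  then have "\<forall>\<^sub>F h in at_right 0. norm ((measure_pmf.expectation (P h x) f - f x) / h - (\<Sum>y\<in>K. D h y * f y))
      \<le> - B * (\<Sum>y\<in>K. D h y)"
    by - (rule eventually_mono[OF eventually_at_right_less], simp only: real_norm_def)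
  moreover have "((\<lambda>h. - B * (\<Sum>y\<in>K. D h y)) \<longlongrightarrow> - B * (\<Sum>y\<in>K. G x y)) (at_right 0)"
    by (intro tendsto_intros D)
  then have "((\<lambda>h. - B * (\<Sum>y\<in>K. D h y)) \<longlongrightarrow> 0) (at_right 0)"
    by (simp only: K(4) mult_zero_right)
  ultimately have diff: "((\<lambda>h. (measure_pmf.expectation (P h x) f - f x) / h - (\<Sum>y\<in>K. D h y * f y)) \<longlongrightarrow> 0) (at_right 0)"
    by (rule Lim_null_comparison)
  have "((\<lambda>h. \<Sum>y\<in>K. D h y * f y) \<longlongrightarrow> (\<Sum>y\<in>K. G x y * f y)) (at_right 0)"
    by (intro tendsto_intros D)
  from tendsto_add[OF diff this] show ?thesis by (simp only: diff_add_cancel add_0)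
qed

end

section \<open>Drift inequalities for limit laws\<close>

lemma countable_valued_law_pmf:
  assumes "prob_space M" "Y \<in> measurable M (count_space S)" "countable S"
  shows "\<exists>p. measure_pmf p = distr M (count_space UNIV) Y"
proof -
  interpret prob_space M by fact
  let ?D = "distr M (count_space UNIV) Y"
  have Y: "Y \<in> measurable M (count_space UNIV)"
    using assms(2) by (rule measurable_compose) simp
  interpret D: prob_space ?D by (rule prob_space_distr[OF Y])
  have "AE x in ?D. x \<in> S"
    using measurable_space[OF assms(2)] Y by (auto simp: AE_distr_iff)
  then have "AE x in ?D. measure ?D {x} \<noteq> 0"
    using assms(3) by (subst D.AE_support_countable) auto
  then have "measure_pmf (Abs_pmf ?D) = ?D"
    by (intro Abs_pmf_inverse) (auto simp: D.prob_space_axioms)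
  then show ?thesis by blast
qed

text \<open>
  The one-dimensional laws \<open>L t\<close> of the process, turned into mass functions, evolve under the
  semigroup: the joint law of \<open>X t\<close> and \<open>X (t + s)\<close> has marginal \<open>L (t + s)\<close>.
\<close>

lemma ctmc_laws:
  assumes ctmc: "is_ctmc M X S G" and S: "countable S"
  shows "\<exists>P L. markov_semigroup S G P \<and>
    (\<forall>t\<ge>0. \<forall>A. measure (measure_pmf (L t)) A = measure M {\<omega>\<in>space M. X t \<omega> \<in> A}) \<and>
    (\<forall>t\<ge>0. set_pmf (L t) \<subseteq> S) \<and>
    (\<forall>s\<ge>0. \<forall>t\<ge>0. L (t + s) = bind_pmf (L t) (P s))"
proof -
  interpret prob_space M using ctmc by (simp add: is_ctmc_def)
  have X: "X t \<in> measurable M (count_space S)" if "t \<ge> 0" for t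
    using ctmc that by (auto simp: is_ctmc_def)
  from ctmc obtain P where P: "markov_semigroup S G P"
    and markov: "\<forall>t\<ge>0. \<forall>s\<ge>0. \<forall>F z. \<forall>x\<in>S. \<forall>y\<in>S. finite F \<longrightarrow> F \<subseteq> {0..t} \<longrightarrow>
        measure M {\<omega>\<in>space M. (\<forall>u\<in>F. X u \<omega> = z u) \<and> X t \<omega> = x \<and> X (t + s) \<omega> = y} =
        measure M {\<omega>\<in>space M. (\<forall>u\<in>F. X u \<omega> = z u) \<and> X t \<omega> = x} * pmf (P s x) y"
    unfolding is_ctmc_def by (elim conjE exE)
  have step: "measure M {\<omega>\<in>space M. X t \<omega> = x \<and> X (t + s) \<omega> = y} =
      measure M {\<omega>\<in>space M. X t \<omega> = x} * pmf (P s x) y"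
    if "t \<ge> 0" "s \<ge> 0" "x \<in> S" "y \<in> S" for t s x y
    using markov[rule_format, OF that, of "{}"] by simp
  have "\<forall>t. \<exists>p. t \<ge> 0 \<longrightarrow> measure_pmf p = distr M (count_space UNIV) (X t)"
    using countable_valued_law_pmf[OF prob_space_axioms X S] by blast
  then obtain L where L: "\<And>t. t \<ge> 0 \<Longrightarrow> measure_pmf (L t) = distr M (count_space UNIV) (X t)"
    by metis
  have measure_L: "measure (measure_pmf (L t)) A = measure M {\<omega>\<in>space M. X t \<omega> \<in> A}" if "t \<ge> 0" for t A
  proof -
    have "X t \<in> measurable M (count_space UNIV)"
      using X[OF that] by (rule measurable_compose) simp
    then show ?thesis using that
      by (auto simp: L measure_distr intro!: arg_cong[of _ _ "measure M"])
  qed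
  have set_L: "set_pmf (L t) \<subseteq> S" if "t \<ge> 0" for t
  proof
    fix x assume "x \<in> set_pmf (L t)"
    then have "measure M {\<omega>\<in>space M. X t \<omega> = x} \<noteq> 0"
      using measure_L[OF that, of "{x}"] by (simp add: set_pmf_iff measure_pmf_single)
    then have "{\<omega>\<in>space M. X t \<omega> = x} \<noteq> {}" by (metis measure_empty)
    then show "x \<in> S" using measurable_space[OF X[OF that]] by auto
  qed
  have "L (t + s) = bind_pmf (L t) (P s)" if st: "s \<ge> 0" "t \<ge> 0" for s t
  proof -
    let ?Y = "\<lambda>\<omega>. (X t \<omega>, X (t + s) \<omega>)"
    have "?Y \<in> measurable M (count_space S \<Otimes>\<^sub>M count_space S)"
      using X[of t] X[of "t + s"] st by (intro measurable_Pair) auto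
    then have Y: "?Y \<in> measurable M (count_space (S \<times> S))"
      by (simp add: pair_measure_countable[OF S S])
    then obtain J where J: "measure_pmf J = distr M (count_space UNIV) ?Y"
      using countable_valued_law_pmf[OF prob_space_axioms Y] S by auto
    have Y': "?Y \<in> measurable M (count_space UNIV)"
      using Y by (rule measurable_compose) simp
    have measure_J: "measure (measure_pmf J) A = measure M {\<omega>\<in>space M. ?Y \<omega> \<in> A}" for A
      using Y' by (auto simp: J measure_distr intro!: arg_cong[of _ _ "measure M"])
    \<comment> \<open>The joint law is given by the Markov property with an empty past.\<close>
    have "J = bind_pmf (L t) (\<lambda>x. map_pmf (Pair x) (P s x))"
    proof (rule pmf_eqI)
      fix z :: "'b \<times> 'b"
      obtain x y where z: "z = (x, y)" by fastforce
      have "pmf (map_pmf (Pair x') (P s x')) z = indicator {x} x' * pmf (P s x) y" for x'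
        by (cases "x' = x") (auto simp: z pmf_map_inj' inj_on_def pmf_eq_0_set_pmf)
      then have rhs: "pmf (bind_pmf (L t) (\<lambda>x. map_pmf (Pair x) (P s x))) z = pmf (L t) x * pmf (P s x) y"
        by (simp add: pmf_bind measure_pmf_single)
      have "pmf J z = measure M {\<omega>\<in>space M. X t \<omega> = x \<and> X (t + s) \<omega> = y}"
        by (simp add: measure_J z flip: measure_pmf_single)
      also have "\<dots> = pmf (L t) x * pmf (P s x) y"
      proof (cases "x \<in> S \<and> y \<in> S")
        case True
        then show ?thesis using st by (simp add: step measure_L flip: measure_pmf_single)
      next
        case False
        then have "{\<omega>\<in>space M. X t \<omega> = x \<and> X (t + s) \<omega> = y} = {}"
          using measurable_space[OF Y] by auto
        moreover have "pmf (L t) x * pmf (P s x) y = 0"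
        proof (cases "x \<in> S")
          case True
          then have "y \<notin> set_pmf (P s x)" using False P st by (auto simp: markov_semigroup_def)
          then show ?thesis by (simp add: set_pmf_iff)
        next
          case False
          then have "x \<notin> set_pmf (L t)" using set_L[OF st(2)] by auto
          then show ?thesis by (simp add: set_pmf_iff)
        qed
        ultimately show ?thesis by (metis measure_empty)
      qed
      finally show "pmf J z = pmf (bind_pmf (L t) (\<lambda>x. map_pmf (Pair x) (P s x))) z"
        by (simp add: rhs)
    qed
    moreover have "L (t + s) = map_pmf snd J"
    proof (rule pmf_eqI)
      fix y show "pmf (L (t + s)) y = pmf (map_pmf snd J) y"
        using st by (simp add: measure_L measure_J pmf_map vimage_def flip: measure_pmf_single)
    qed
    ultimately show ?thesis
      by (simp add: map_bind_pmf pmf.map_comp o_def)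
  qed
  with P measure_L set_L show ?thesis by (intro exI[of _ P] exI[of _ L]) auto
qed

lemma finite_set_almost_full_pmf:
  fixes p :: "'a pmf"
  assumes "e > 0"
  obtains A where "finite A" "1 - measure (measure_pmf p) A < e"
proof -
  define A where "A n = {x \<in> set_pmf p. to_nat_on (set_pmf p) x < n}" for n
  have fin: "finite (A n)" for n
    by (rule inj_on_finite[of "to_nat_on (set_pmf p)" _ "{..<n}"])
       (auto simp: A_def intro: inj_on_subset[OF inj_on_to_nat_on])
  have "(\<lambda>n. measure (measure_pmf p) (A n)) \<longlonglongrightarrow> measure (measure_pmf p) (\<Union>n. A n)"
    by (rule measure_pmf.finite_Lim_measure_incseq) (auto simp: A_def incseq_def)
  moreover have "(\<Union>n. A n) = set_pmf p" by (auto simp: A_def)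
  moreover have "measure (measure_pmf p) (set_pmf p) = 1"
    by (simp add: measure_pmf.prob_eq_1 AE_measure_pmf_iff)
  ultimately have "(\<lambda>n. measure (measure_pmf p) (A n)) \<longlonglongrightarrow> 1" by simp
  then have "\<forall>\<^sub>F n in sequentially. 1 - e < measure (measure_pmf p) (A n)"
    using assms by (intro order_tendstoD(1)) auto
  then obtain n where "1 - e < measure (measure_pmf p) (A n)"
    using eventually_happens by (metis sequentially_bot)
  then show ?thesis using that[of "A n"] fin by simp
qed

text \<open>
  Pointwise limits of mass functions could lose mass at infinity. Here the limit is itself a mass
  function, so a finite set that nearly exhausts it also nearly exhausts the approximating laws.
\<close>

lemma pmf_limit_expectation_le:
  fixes H :: "'a \<Rightarrow> real"
  assumes lim: "\<And>z. ((\<lambda>t. pmf (\<nu> t) z) \<longlongrightarrow> pmf \<rho> z) F"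
    and H: "\<And>z. \<bar>H z\<bar> \<le> C" and e: "e > 0"
  shows "\<forall>\<^sub>F t in F. measure_pmf.expectation (\<nu> t) H < measure_pmf.expectation \<rho> H + e"
proof -
  have C: "0 \<le> C" using H[of undefined] by linarith
  have "e / (2 * C + 1) > 0" using e C by simp
  then obtain A where A: "finite A" "1 - measure (measure_pmf \<rho>) A < e / (2 * C + 1)"
    by (rule finite_set_almost_full_pmf)
  \<comment> \<open>On \<open>A\<close> the integrand is kept; off \<open>A\<close> it is replaced by its bound. As a function of finitely
    many point masses, \<open>U\<close> is continuous along the filter.\<close>
  define U where "U p = (\<Sum>z\<in>A. H z * pmf p z) + C * (1 - (\<Sum>z\<in>A. pmf p z))" for p
  have split: "(\<Sum>z\<in>A. H z * pmf p z) = measure_pmf.expectation p (\<lambda>z. H z * indicator A z)" for p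
    using A(1) by (subst integral_measure_pmf_real[of A p "\<lambda>y. H y * indicator A y"])
       (auto simp: indicator_def intro!: sum.cong split: if_splits)
  have pA: "(\<Sum>z\<in>A. pmf p z) = measure (measure_pmf p) A" for p
    using A by (simp add: measure_measure_pmf_finite)
  have i: "integrable (measure_pmf p) H" for p
    using H by (rule integrable_pmf_bounded)
  have iA: "integrable (measure_pmf p) (\<lambda>z. H z * indicator A z)" for p
    by (rule integrable_pmf_bounded[where B=C]) (use H C in \<open>simp add: indicator_def\<close>)
  have i1: "integrable (measure_pmf p) (\<lambda>z. C * (1 - indicator A z))" for p
    by (rule integrable_pmf_bounded[where B=C]) (use C in \<open>simp add: indicator_def\<close>)
  have C1: "measure_pmf.expectation p (\<lambda>z. C * (1 - indicator A z)) = C * (1 - (\<Sum>z\<in>A. pmf p z))" for p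
    by (simp add: pA integrable_pmf_bounded[of _ 1])
  have upper: "measure_pmf.expectation p H \<le> U p" for p
  proof -
    have "measure_pmf.expectation p H \<le> measure_pmf.expectation p (\<lambda>z. H z * indicator A z + C * (1 - indicator A z))"
      using H by (intro integral_mono Bochner_Integration.integrable_add i iA i1) (auto simp: indicator_def abs_le_iff)
    also have "\<dots> = U p"
      unfolding U_def split C1[symmetric] by (intro Bochner_Integration.integral_add iA i1)
    finally show ?thesis .
  qed
  have "((\<lambda>t. U (\<nu> t)) \<longlongrightarrow> U \<rho>) F"
    unfolding U_def by (intro tendsto_intros lim)
  moreover have "U \<rho> < measure_pmf.expectation \<rho> H + e"
  proof -
    have "measure_pmf.expectation \<rho> (\<lambda>z. H z * indicator A z)
        \<le> measure_pmf.expectation \<rho> (\<lambda>z. H z + C * (1 - indicator A z))"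
    proof (intro integral_mono Bochner_Integration.integrable_add i iA i1)
      fix z show "H z * indicator A z \<le> H z + C * (1 - indicator A z)"
        using H[of z] by (auto simp: indicator_def)
    qed
    also have "\<dots> = measure_pmf.expectation \<rho> H + C * (1 - (\<Sum>z\<in>A. pmf \<rho> z))"
      unfolding C1[symmetric] by (intro Bochner_Integration.integral_add i i1)
    finally have "U \<rho> \<le> measure_pmf.expectation \<rho> H + 2 * C * (1 - measure (measure_pmf \<rho>) A)"
      by (simp add: U_def split pA)
    also have "2 * C * (1 - measure (measure_pmf \<rho>) A) \<le> 2 * C * (e / (2 * C + 1))"
      using A C by (intro mult_left_mono) auto
    also have "\<dots> < e" using C e by (simp add: field_simps)
    finally show ?thesis by simp
  qed
  ultimately have "\<forall>\<^sub>F t in F. U (\<nu> t) < measure_pmf.expectation \<rho> H + e"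
    by (rule order_tendstoD(2))
  then show ?thesis
    by eventually_elim (use upper in \<open>blast intro: le_less_trans\<close>)
qed

lemma limit_law_support:
  assumes ctmc: "is_ctmc M X S G"
    and lim: "\<And>z. ((\<lambda>t. measure M {\<omega>\<in>space M. \<phi> (X t \<omega>) = z}) \<longlongrightarrow> pmf \<rho> z) at_top"
    and z: "z \<in> set_pmf \<rho>"
  shows "z \<in> \<phi> ` S"
proof (rule ccontr)
  assume "z \<notin> \<phi> ` S"
  have zero: "measure M {\<omega>\<in>space M. \<phi> (X t \<omega>) = z} = 0" if "t \<ge> 0" for t
  proof -
    have "X t \<in> measurable M (count_space S)"
      using ctmc that unfolding is_ctmc_def by blast
    then have "X t \<omega> \<in> S" if "\<omega> \<in> space M" for \<omega>
      using that by (simp add: measurable_def Pi_iff)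
    with \<open>z \<notin> \<phi> ` S\<close> have "{\<omega>\<in>space M. \<phi> (X t \<omega>) = z} = {}" by blast
    then show ?thesis by (metis measure_empty)
  qed
  have "\<forall>\<^sub>F t in at_top. measure M {\<omega>\<in>space M. \<phi> (X t \<omega>) = z} = 0"
    using eventually_ge_at_top[of 0] by eventually_elim (rule zero)
  then have "pmf \<rho> z = 0"
    by (intro tendsto_unique[OF trivial_limit_at_top_linorder lim[of z] tendsto_eventually])
  with z show False by (simp add: set_pmf_iff)
qed

text \<open>
  A drift inequality in equilibrium, for a function \<open>\<phi>\<close> of the process whose law converges to
  \<open>\<rho>\<close>. The bounded function \<open>E f (X t)\<close> has right derivative at most \<open>E H (\<phi> (X t))\<close>. If the
  \<open>\<rho>\<close>-expectation of \<open>H\<close> were negative, this derivative would eventually stay below a negative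
  constant, and \<open>E f (X t)\<close> would be unbounded. Only the law of
  \<open>\<phi> (X t)\<close> is assumed to converge, while \<open>f\<close> may depend on the full state.
\<close>

lemma stationary_drift_nonneg:
  fixes f :: "'a \<Rightarrow> real" and H :: "'b \<Rightarrow> real" and \<rho> :: "'b pmf"
  assumes ctmc: "is_ctmc M X S G" and S: "countable S"
    and rate: "\<And>x. x \<in> S \<Longrightarrow> - q \<le> G x x"
    and K: "\<And>x. x \<in> S \<Longrightarrow> finite (K x)" "\<And>x. x \<in> S \<Longrightarrow> K x \<subseteq> S" "\<And>x. x \<in> S \<Longrightarrow> x \<in> K x"
      "\<And>x. x \<in> S \<Longrightarrow> (\<Sum>y\<in>K x. G x y) = 0"
    and f: "\<And>y. \<bar>f y\<bar> \<le> B"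
    and drift: "\<And>x. x \<in> S \<Longrightarrow> (\<Sum>y\<in>K x. G x y * f y) \<le> H (\<phi> x)"
    and Hb: "\<And>x. x \<in> S \<Longrightarrow> \<bar>H (\<phi> x)\<bar> \<le> C"
    and lim: "\<And>z. ((\<lambda>t. measure M {\<omega>\<in>space M. \<phi> (X t \<omega>) = z}) \<longlongrightarrow> pmf \<rho> z) at_top"
  shows "0 \<le> measure_pmf.expectation \<rho> H"
proof (rule ccontr)
  assume neg: "\<not> ?thesis"
  obtain P L where P: "markov_semigroup S G P"
    and "\<forall>t\<ge>0. \<forall>A. measure (measure_pmf (L t)) A = measure M {\<omega>\<in>space M. X t \<omega> \<in> A}"
    and "\<forall>t\<ge>0. set_pmf (L t) \<subseteq> S"
    and "\<forall>s\<ge>0. \<forall>t\<ge>0. L (t + s) = bind_pmf (L t) (P s)"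
    using ctmc_laws[OF ctmc S] by (elim exE conjE)
  note L = this(2)[rule_format] and set_L = this(3)[rule_format] and L_step = this(4)[rule_format]
  interpret bounded_rate_semigroup S G P q
    by unfold_locales (use P rate in auto)
  have nu: "((\<lambda>t. pmf (map_pmf \<phi> (L t)) z) \<longlongrightarrow> pmf \<rho> z) at_top" for z
  proof (rule Lim_transform_eventually[OF lim])
    show "\<forall>\<^sub>F t in at_top. measure M {\<omega>\<in>space M. \<phi> (X t \<omega>) = z} = pmf (map_pmf \<phi> (L t)) z"
      using eventually_ge_at_top[of 0] by eventually_elim (simp add: pmf_map L)
  qed
  have rho: "z \<in> \<phi> ` S" if "z \<in> set_pmf \<rho>" for z
    using ctmc lim that by (rule limit_law_support)
  \<comment> \<open>The bound on \<open>H\<close> is only known where the process lives.\<close>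
  define H' where "H' z = (if z \<in> \<phi> ` S then H z else 0)" for z
  have "S \<noteq> {}" using set_L[of 0] set_pmf_not_empty[of "L 0"] by auto
  then have "0 \<le> C" using Hb by fastforce
  then have H': "\<bar>H' z\<bar> \<le> C" for z using Hb by (auto simp: H'_def)
  have "measure_pmf.expectation \<rho> H' = measure_pmf.expectation \<rho> H"
    using rho by (intro integral_cong_AE) (auto simp: AE_measure_pmf_iff H'_def)
  with neg have neg: "measure_pmf.expectation \<rho> H' < 0" by simp
  define c where "c = - measure_pmf.expectation \<rho> H' / 2"
  have c: "c > 0" and c2: "measure_pmf.expectation \<rho> H' + c = - c" using neg by (auto simp: c_def)
  have "\<forall>\<^sub>F t in at_top. measure_pmf.expectation (L t) (\<lambda>x. H' (\<phi> x)) < - c"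
    using pmf_limit_expectation_le[of "\<lambda>t. map_pmf \<phi> (L t)" \<rho> at_top H' C c, OF nu H' c]
    by (simp only: c2 integral_map_pmf)
  then obtain T0 where T0: "\<And>t. t \<ge> T0 \<Longrightarrow> measure_pmf.expectation (L t) (\<lambda>x. H' (\<phi> x)) < - c"
    by (auto simp: eventually_at_top_linorder)
  define T where "T = max 0 T0"
  have T: "T \<ge> 0" by (simp add: T_def)
  have drift_H: "measure_pmf.expectation (L t) (\<lambda>x. H' (\<phi> x)) < - c" if "t \<ge> T" for t
    using T0 that by (simp add: T_def)
  define u where "u t = measure_pmf.expectation (L t) f" for t
  have u_bound: "\<bar>u t\<bar> \<le> B" for t unfolding u_def using f by (intro abs_expectation_le)
  define D where "D h x = measure_pmf.expectation (P h x) f - f x" for h x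
  have D_bound: "\<bar>D h x\<bar> \<le> 2 * B * q * h" if "h \<ge> 0" "x \<in> S" for h x
    unfolding D_def using that f by (intro expectation_increment_le) auto
  have u_step: "u (t + h) - u t = measure_pmf.expectation (L t) (D h)" if "t \<ge> 0" "h \<ge> 0" for t h
  proof -
    have "integrable (L t) (\<lambda>x. measure_pmf.expectation (P h x) f)" and "integrable (L t) f"
      using f by (auto intro!: integrable_pmf_bounded[where B=B] abs_expectation_le)
    then show ?thesis
      by (simp add: u_def L_step[OF that(2,1)] D_def[abs_def] expectation_bind_pmf_bounded[where f=f, OF f])
  qed
  have u_incr: "\<bar>u (t + h) - u t\<bar> \<le> 2 * B * q * h" if "t \<ge> 0" "h \<ge> 0" for t h
    using that set_L[of t] D_bound by (auto simp: u_step intro!: abs_expectation_le)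
  have "\<bar>2 * B * q\<bar>-lipschitz_on {0..} u"
  proof (rule lipschitz_onI)
    fix s t :: real assume "s \<in> {0..}" "t \<in> {0..}"
    then show "dist (u s) (u t) \<le> \<bar>2 * B * q\<bar> * dist s t"
    proof (induction s t rule: linorder_wlog)
      case (le s t)
      then have "\<bar>u t - u s\<bar> \<le> 2 * B * q * (t - s)" using u_incr[of s "t - s"] by simp
      also have "\<dots> \<le> \<bar>2 * B * q\<bar> * (t - s)" using le by (intro mult_right_mono) auto
      finally show ?case using le by (simp add: dist_real_def abs_minus_commute)
    qed (simp add: dist_commute)
  qed simp
  then have u_cont: "continuous_on {0..} u" by (rule lipschitz_on_continuous_on)
  have decr: "\<forall>\<^sub>F h in at_right 0. u (t + h) - u t \<le> - c * h" if t: "t \<ge> T" for t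
  proof -
    let ?g = "\<lambda>x. \<Sum>y\<in>K x. G x y * f y"
    have t0: "t \<ge> 0" using t T by simp
    have AE_S: "AE x in L t. x \<in> S" using set_L[OF t0] by (auto simp: AE_measure_pmf_iff)
    have lim1: "AE x in L t. ((\<lambda>r. D (inverse r) x / inverse r) \<longlongrightarrow> ?g x) at_top"
      using AE_S
    proof eventually_elim
      case (elim x)
      then have "((\<lambda>h. D h x / h) \<longlongrightarrow> ?g x) (at_right 0)"
        unfolding D_def using f K by (intro generator_tendsto) auto
      then show ?case by (simp only: filterlim_at_right_to_top)
    qed
    have dom: "\<forall>\<^sub>F r in at_top. AE x in L t. norm (D (inverse r) x / inverse r) \<le> 2 * B * q"
      using eventually_gt_at_top[of 0]
    proof eventually_elim
      case (elim r)
      show ?case using AE_S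
      proof eventually_elim
        case (elim x)
        then show ?case using D_bound[of "inverse r" x] \<open>0 < r\<close> by (simp add: abs_mult field_simps)
      qed
    qed
    have g_int: "integrable (L t) ?g"
      by (rule integrable_dominated_convergence_at_top[OF _ _ _ lim1 dom]) simp_all
    have "((\<lambda>r. measure_pmf.expectation (L t) (\<lambda>x. D (inverse r) x / inverse r))
        \<longlongrightarrow> measure_pmf.expectation (L t) ?g) at_top"
      by (rule integral_dominated_convergence_at_top[OF _ _ _ lim1 dom]) simp_all
    then have "((\<lambda>h. measure_pmf.expectation (L t) (\<lambda>x. D h x / h))
        \<longlongrightarrow> measure_pmf.expectation (L t) ?g) (at_right 0)"
      by (simp only: filterlim_at_right_to_top)
    moreover have "measure_pmf.expectation (L t) ?g \<le> measure_pmf.expectation (L t) (\<lambda>x. H' (\<phi> x))"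
      using AE_S drift by (intro integral_mono_AE g_int integrable_pmf_bounded[of _ C] H')
        (auto simp: H'_def elim!: eventually_mono)
    then have "measure_pmf.expectation (L t) ?g < - c" using drift_H[OF t] by simp
    ultimately have "\<forall>\<^sub>F h in at_right 0. measure_pmf.expectation (L t) (\<lambda>x. D h x / h) < - c"
      by (rule order_tendstoD(2))
    moreover have "\<forall>\<^sub>F h in at_right 0. (0::real) < h" by (simp add: eventually_at_right_less)
    ultimately show ?thesis
    proof eventually_elim
      case (elim h)
      then show ?case using u_step[of t h] t0 by (simp add: field_simps)
    qed
  qed
  \<comment> \<open>By this time a decrease at rate \<open>c\<close> exceeds the range \<open>2 * B\<close> of \<open>u\<close>.\<close>
  define b where "b = T + (2 * B + 1) / c"
  have B: "0 \<le> B" using f[of undefined] by linarith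
  have "u b - u T \<le> - c * (b - T)"
    by (rule growth_le_if_right_increments_le)
       (use T B c decr in \<open>auto simp: b_def intro: continuous_on_subset[OF u_cont]\<close>)
  also have "\<dots> = - (2 * B + 1)" using c by (simp add: b_def)
  finally show False using u_bound[of b] u_bound[of T] by linarith
qed

section \<open>Transitions of the JSQ(d) system\<close>

text \<open>
  Agrees with the occupancy state at all levels from 1 on, but has value 1 at level 0, as the
  balance equations for level 1 require.
\<close>

definition frac_at_least :: "nat \<Rightarrow> nat list \<Rightarrow> nat \<Rightarrow> real" where
  "frac_at_least N x i = real (card {k. k < N \<and> i \<le> x ! k}) / real N"

lemma frac_at_least_nonneg: "0 \<le> frac_at_least N x i"
  by (simp add: frac_at_least_def)

lemma frac_at_least_le_1: "frac_at_least N x i \<le> 1"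
proof -
  have "card {k. k < N \<and> i \<le> x ! k} \<le> card {..<N}" by (rule card_mono) auto
  then show ?thesis by (simp add: frac_at_least_def divide_simps)
qed

lemma frac_at_least_0: "N \<ge> 1 \<Longrightarrow> frac_at_least N x 0 = 1"
  by (simp add: frac_at_least_def)

lemma occupancy_eq_frac_at_least:
  assumes "x \<in> queue_states N b" "i \<ge> 1"
  shows "occupancy N b x i = frac_at_least N x i"
proof (cases "enat i \<le> b")
  case False
  have "\<not> i \<le> x ! k" if "k < N" for k
  proof
    assume "i \<le> x ! k"
    then have "enat i \<le> enat (x ! k)" by simp
    also have "\<dots> \<le> b" using assms(1) that by (simp add: queue_states_def)
    finally show False using False by simp
  qed
  then have "{k. k < N \<and> i \<le> x ! k} = {}" by auto
  then show ?thesis using False by (simp add: occupancy_def levels_def frac_at_least_def)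
qed (use assms in \<open>simp add: occupancy_def levels_def frac_at_least_def\<close>)

text \<open>
  The ratio form is \<open>(m choose d) / (n choose d) \<le> (m / n) ^ d\<close>: sampling without replacement
  makes it less likely than sampling with replacement to stay inside a subset.
\<close>

lemma choose_mult_power_le: "m \<le> n \<Longrightarrow> (m choose d) * n ^ d \<le> (n choose d) * m ^ d"
proof (induction d)
  case (Suc d)
  have absorb: "Suc d * (r choose Suc d) = (r - d) * (r choose d)" for r
    using binomial_absorption[of d "r"] binomial_absorb_comp[of r d] by simp
  have "(m - d) * n \<le> m * (n - d)"
    using Suc.prems by (simp add: diff_mult_distrib diff_mult_distrib2 mult.commute diff_le_mono2)
  have "Suc d * ((m choose Suc d) * n ^ Suc d) = ((m choose d) * n ^ d) * ((m - d) * n)"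
    unfolding mult.assoc[symmetric] absorb by (simp only: mult_ac power_Suc)
  also have "\<dots> \<le> ((n choose d) * m ^ d) * (m * (n - d))"
    by (rule mult_le_mono) (rule Suc.IH[OF Suc.prems], fact)
  also have "\<dots> = Suc d * ((n choose Suc d) * m ^ Suc d)"
    unfolding mult.assoc[symmetric] absorb by (simp only: mult_ac power_Suc)
  finally show ?case by (simp only: mult_le_cancel1)
qed simp

lemma finite_server_samples: "finite (server_samples N d)"
  by (rule finite_subset[of _ "Pow {..<N}"]) (auto simp: server_samples_def)

lemma server_samples_nonempty:
  assumes "d \<le> N" shows "server_samples N d \<noteq> {}"
proof -
  have "{..<d} \<in> server_samples N d" using assms by (auto simp: server_samples_def)
  then show ?thesis by blast
qed

lemma prob_sample_subset_le:
  assumes "A \<subseteq> {..<N}" "d \<le> N" "N \<ge> 1"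
  shows "measure (pmf_of_set (server_samples N d)) {D. D \<subseteq> A} \<le> (real (card A) / real N) ^ d"
proof -
  have fin: "finite A" using assms(1) finite_subset by blast
  have "server_samples N d \<inter> {D. D \<subseteq> A} = {D. D \<subseteq> A \<and> card D = d}"
    using assms(1) by (auto simp: server_samples_def)
  then have "measure (pmf_of_set (server_samples N d)) {D. D \<subseteq> A} = real (card A choose d) / real (N choose d)"
    using server_samples_nonempty[OF assms(2)] finite_server_samples fin n_subsets[of "{..<N}" d]
    by (simp add: measure_pmf_of_set n_subsets server_samples_def)
  also have "\<dots> \<le> real (card A) ^ d / real N ^ d"
  proof -
    have "card A \<le> N" using card_mono[OF _ assms(1)] by simp
    then have "real ((card A choose d) * N ^ d) \<le> real ((N choose d) * card A ^ d)"
      by (intro of_nat_mono choose_mult_power_le)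
    moreover have "0 < N choose d" using assms(2) by simp
    ultimately show ?thesis using assms(3) by (simp add: field_simps)
  qed
  finally show ?thesis by (simp add: power_divide)
qed

text \<open>
  A task joins a queue of length at least \<open>j\<close> only if all sampled queues are that long, however
  ties are broken. The bound \<open>\<alpha> + \<beta> * of_bool (j \<le> x ! k)\<close> separates such arrivals from the others.
\<close>

lemma expectation_after_arrival_le:
  assumes tie: "tie_breaking N b d tie" and x: "x \<in> queue_states N b" and d: "d \<le> N" "N \<ge> 1"
    and f: "\<And>y. \<bar>f y\<bar> \<le> (B::real)" and \<beta>: "0 \<le> \<beta>"
    and step: "\<And>k. k < N \<Longrightarrow>
      f (if enat (x ! k) < b then x[k := x ! k + 1] else x) - f x \<le> \<alpha> + \<beta> * of_bool (j \<le> x ! k)"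
  shows "measure_pmf.expectation (after_arrival N b d tie x) f - f x \<le> \<alpha> + \<beta> * frac_at_least N x j ^ d"
proof -
  let ?s = "pmf_of_set (server_samples N d)"
  let ?new = "\<lambda>k. if enat (x ! k) < b then x[k := x ! k + 1] else x"
  let ?A = "{k. k < N \<and> j \<le> x ! k}"
  have samples: "set_pmf ?s = server_samples N d"
    using server_samples_nonempty[OF d(1)] finite_server_samples by simp
  have given_sample: "measure_pmf.expectation (tie x D) (\<lambda>k. f (?new k)) \<le> f x + \<alpha> + \<beta> * indicator {D. D \<subseteq> ?A} D"
    if D: "D \<in> server_samples N d" for D
  proof (rule measure_pmf.integral_le_const)
    show "AE k in tie x D. f (?new k) \<le> f x + \<alpha> + \<beta> * indicator {D. D \<subseteq> ?A} D"
    proof (rule AE_pmfI)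
      fix k assume "k \<in> set_pmf (tie x D)"
      then have k: "k \<in> D" "\<forall>i\<in>D. x ! k \<le> x ! i"
        using tie x D by (auto simp: tie_breaking_def shortest_def)
      have DN: "D \<subseteq> {..<N}" using D by (auto simp: server_samples_def)
      \<comment> \<open>A shortest queue of length at least \<open>j\<close> means that the whole sample lies in \<open>?A\<close>.\<close>
      have "of_bool (j \<le> x ! k) \<le> (indicator {D. D \<subseteq> ?A} D :: real)"
        using k DN by (auto simp: indicator_def intro: order_trans)
      then have "\<beta> * of_bool (j \<le> x ! k) \<le> \<beta> * indicator {D. D \<subseteq> ?A} D"
        using \<beta> by (rule mult_left_mono)
      with step[of k] k DN show "f (?new k) \<le> f x + \<alpha> + \<beta> * indicator {D. D \<subseteq> ?A} D" by auto
    qed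
  qed (use f in \<open>auto intro!: integrable_pmf_bounded[where B=B]\<close>)
  have "measure_pmf.expectation (after_arrival N b d tie x) f
      = measure_pmf.expectation ?s (\<lambda>D. measure_pmf.expectation (tie x D) (\<lambda>k. f (?new k)))"
    unfolding after_arrival_def expectation_bind_pmf_bounded[where f=f, OF f] by simp
  also have "\<dots> \<le> measure_pmf.expectation ?s (\<lambda>D. f x + \<alpha> + \<beta> * indicator {D. D \<subseteq> ?A} D)"
    by (rule integral_mono_AE)
       (use given_sample finite_server_samples in \<open>auto simp: AE_measure_pmf_iff samples intro!: integrable_measure_pmf_finite\<close>)
  also have "\<dots> = f x + \<alpha> + \<beta> * measure ?s {D. D \<subseteq> ?A}"
    using integrable_measure_pmf_finite[of ?s "\<lambda>D. \<beta> * indicator {D. D \<subseteq> ?A} D"] finite_server_samples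
    by (simp add: samples)
  also have "\<dots> \<le> f x + \<alpha> + \<beta> * frac_at_least N x j ^ d"
    unfolding frac_at_least_def using d \<beta> by (intro add_left_mono mult_left_mono prob_sample_subset_le) auto
  finally show ?thesis by simp
qed

text \<open>
  The state \<open>x\<close> is included so that the rates out of \<open>x\<close>, with the diagonal entry, sum to 0 over
  this finite set.
\<close>

definition jsq_moves :: "nat \<Rightarrow> enat \<Rightarrow> nat list \<Rightarrow> nat list set" where
  "jsq_moves N b x = insert x
     ((\<lambda>k. x[k := x ! k + 1]) ` {k. k < N \<and> enat (x ! k) < b} \<union> (\<lambda>k. x[k := x ! k - 1]) ` {..<N})"

lemma jsq_moves_basic:
  assumes "x \<in> queue_states N b"
  shows "finite (jsq_moves N b x)" "x \<in> jsq_moves N b x" "jsq_moves N b x \<subseteq> queue_states N b"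
proof -
  show "jsq_moves N b x \<subseteq> queue_states N b"
  proof
    fix y assume "y \<in> jsq_moves N b x"
    then consider "y = x" | k where "k < N" "enat (x ! k) < b" "y = x[k := x ! k + 1]"
      | k where "k < N" "y = x[k := x ! k - 1]"
      by (auto simp: jsq_moves_def)
    then show "y \<in> queue_states N b"
    proof cases
      case 2
      then have "enat (x ! k + 1) \<le> b" using Suc_ile_eq[of "x ! k" b] by simp
      with 2 assms show ?thesis by (auto simp: queue_states_def nth_list_update)
    next
      case 3
      have "enat (x ! k - 1) \<le> enat (x ! k)" by simp
      also have "\<dots> \<le> b" using assms 3 by (simp add: queue_states_def)
      finally show ?thesis using 3 assms by (auto simp: queue_states_def nth_list_update)
    qed (use assms in simp)
  qed
qed (auto simp: jsq_moves_def)

lemma set_after_arrival_subset: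
  assumes tie: "tie_breaking N b d tie" and x: "x \<in> queue_states N b" and d: "d \<le> N"
  shows "set_pmf (after_arrival N b d tie x) \<subseteq> jsq_moves N b x"
proof
  fix y assume "y \<in> set_pmf (after_arrival N b d tie x)"
  then obtain D k where D: "D \<in> server_samples N d" and k: "k \<in> set_pmf (tie x D)"
    and y: "y = (if enat (x ! k) < b then x[k := x ! k + 1] else x)"
    using server_samples_nonempty[OF d] finite_server_samples[of N d]
    by (auto simp: after_arrival_def)
  have "set_pmf (tie x D) \<subseteq> shortest x D" using tie x D by (simp add: tie_breaking_def)
  then have "k \<in> D" using k by (auto simp: shortest_def)
  then have "k < N" using D by (auto simp: server_samples_def)
  then show "y \<in> jsq_moves N b x" by (auto simp: jsq_moves_def y)
qed

lemma jsq_generator: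
  assumes tie: "tie_breaking N b d tie" and x: "x \<in> queue_states N b" and d: "d \<le> N"
  shows "(\<Sum>y\<in>jsq_moves N b x. jsq_rates N b d tie l x y * f y) =
    l * (measure_pmf.expectation (after_arrival N b d tie x) f - f x) +
    (\<Sum>k | k < N \<and> 0 < x ! k. f (x[k := x ! k - 1]) - f x)"
proof -
  let ?K = "jsq_moves N b x" and ?a = "after_arrival N b d tie x"
  note fin = jsq_moves_basic(1)[OF x]
  have pick: "(\<Sum>y\<in>?K. of_bool (z = y) * f y) = f z" if "z \<in> ?K" for z
  proof -
    have "(\<Sum>y\<in>?K. of_bool (z = y) * f y) = (\<Sum>y\<in>?K. if z = y then f y else 0)"
      by (intro sum.cong) auto
    then show ?thesis using fin that by simp
  qed
  have arr: "(\<Sum>y\<in>?K. pmf ?a y * f y) = measure_pmf.expectation ?a f"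
    using set_after_arrival_subset[OF assms] fin
    by (subst integral_measure_pmf_real[of ?K]) (auto simp: mult.commute intro!: sum.cong)
  have dep: "(\<Sum>y\<in>?K. (\<Sum>k | k < N \<and> 0 < x ! k. of_bool (x[k := x ! k - 1] = y) - of_bool (x = y)) * f y)
      = (\<Sum>k | k < N \<and> 0 < x ! k. f (x[k := x ! k - 1]) - f x)"
  proof -
    have "(\<Sum>y\<in>?K. (\<Sum>k | k < N \<and> 0 < x ! k. of_bool (x[k := x ! k - 1] = y) - of_bool (x = y)) * f y)
      = (\<Sum>k | k < N \<and> 0 < x ! k. \<Sum>y\<in>?K. of_bool (x[k := x ! k - 1] = y) * f y - of_bool (x = y) * f y)"
      by (subst sum.swap) (simp add: sum_distrib_right left_diff_distrib)
    also have "\<dots> = (\<Sum>k | k < N \<and> 0 < x ! k. f (x[k := x ! k - 1]) - f x)"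
    proof (intro sum.cong refl)
      fix k assume "k \<in> {k. k < N \<and> 0 < x ! k}"
      then have "x[k := x ! k - 1] \<in> ?K" "x \<in> ?K" by (auto simp: jsq_moves_def)
      then show "(\<Sum>y\<in>?K. of_bool (x[k := x ! k - 1] = y) * f y - of_bool (x = y) * f y) = f (x[k := x ! k - 1]) - f x"
        by (simp only: sum_subtractf pick)
    qed
    finally show ?thesis .
  qed
  have "(\<Sum>y\<in>?K. jsq_rates N b d tie l x y * f y) =
     l * ((\<Sum>y\<in>?K. pmf ?a y * f y) - (\<Sum>y\<in>?K. of_bool (x = y) * f y)) +
     (\<Sum>y\<in>?K. (\<Sum>k | k < N \<and> 0 < x ! k. of_bool (x[k := x ! k - 1] = y) - of_bool (x = y)) * f y)"
    unfolding jsq_rates_def distrib_right sum.distrib left_diff_distrib right_diff_distrib sum_subtractf sum_distrib_left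
    by (simp add: mult.assoc)
  then show ?thesis
    using pick[of x] jsq_moves_basic(2)[OF x] by (simp only: arr dep)
qed

lemma jsq_exit_rate:
  assumes "0 \<le> l" shows "- (l + real N) \<le> jsq_rates N b d tie l x x"
proof -
  have "- l \<le> l * (pmf (after_arrival N b d tie x) x - of_bool (x = x))"
    using mult_left_mono[OF pmf_nonneg assms, of "after_arrival N b d tie x" x] by (simp add: algebra_simps)
  moreover have "- real N \<le> (\<Sum>k | k < N \<and> 0 < x ! k. of_bool (x[k := x ! k - 1] = x) - of_bool (x = x))"
  proof -
    have "card {k. k < N \<and> 0 < x ! k} \<le> card {..<N}" by (rule card_mono) auto
    then have "- real N \<le> (\<Sum>k | k < N \<and> 0 < x ! k. - 1)" by simp
    also have "\<dots> \<le> (\<Sum>k | k < N \<and> 0 < x ! k. of_bool (x[k := x ! k - 1] = x) - of_bool (x = x))"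
      by (rule sum_mono) auto
    finally show ?thesis .
  qed
  ultimately show ?thesis by (simp add: jsq_rates_def)
qed

lemma sum_nth_list_update:
  fixes g :: "nat \<Rightarrow> real"
  assumes "length x = N" "k < N"
  shows "(\<Sum>i<N. g (x[k := v] ! i)) = (\<Sum>i<N. g (x ! i)) + (g v - g (x ! k))"
proof -
  have "(\<Sum>i<N. g (x[k := v] ! i)) = (\<Sum>i<N. g (x ! i) + (if i = k then g v - g (x ! k) else 0))"
    using assms by (intro sum.cong) (auto simp: nth_list_update)
  then show ?thesis using assms by (simp add: sum.distrib)
qed

section \<open>Moments of the occupancy state in equilibrium\<close>

text \<open>
  The \<open>N\<close>-th system together with the limit law \<open>\<rho>\<close> of its occupancy state. This law charges
  only the countably many occupancy states of the system and is therefore a mass function.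
\<close>

locale stationary_jsq =
  fixes N :: nat and b :: enat and d tie l and M :: "'w measure" and X and \<rho> :: "(nat \<Rightarrow> real) pmf"
  assumes b: "1 \<le> b" and N: "1 \<le> N" and d: "1 \<le> d" "d \<le> N" and l: "0 \<le> l"
    and system: "jsq_system N b d tie l M X"
    and lim: "\<And>z. ((\<lambda>t. measure M {\<omega>\<in>space M. occupancy N b (X t \<omega>) = z}) \<longlongrightarrow> pmf \<rho> z) at_top"
begin

lemma support: "z \<in> set_pmf \<rho> \<Longrightarrow> z \<in> occupancy N b ` queue_states N b"
  using system lim by (intro limit_law_support[of M X]) (auto simp: jsq_system_def)

lemma drift_nonneg:
  assumes f: "\<And>y. \<bar>f y\<bar> \<le> B" and \<beta>: "\<And>x. 0 \<le> \<beta> x"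
    and arrival: "\<And>x k. x \<in> queue_states N b \<Longrightarrow> k < N \<Longrightarrow>
      f (if enat (x ! k) < b then x[k := x ! k + 1] else x) - f x \<le> \<alpha> x + \<beta> x * of_bool (j \<le> x ! k)"
    and drift: "\<And>x. x \<in> queue_states N b \<Longrightarrow> l * (\<alpha> x + \<beta> x * frac_at_least N x j ^ d) +
      (\<Sum>k | k < N \<and> 0 < x ! k. f (x[k := x ! k - 1]) - f x) \<le> H (occupancy N b x)"
    and H: "\<And>x. x \<in> queue_states N b \<Longrightarrow> \<bar>H (occupancy N b x)\<bar> \<le> C"
  shows "0 \<le> measure_pmf.expectation \<rho> H"
proof (rule stationary_drift_nonneg[where f=f and \<phi>="occupancy N b" and K="jsq_moves N b" and q="l + real N"])
  have tie: "tie_breaking N b d tie" using system by (simp add: jsq_system_def)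
  show "is_ctmc M X (queue_states N b) (jsq_rates N b d tie l)" using system by (simp add: jsq_system_def)
  show "countable (queue_states N b)" by (rule countableI_type)
  fix x assume x: "x \<in> queue_states N b"
  show "- (l + real N) \<le> jsq_rates N b d tie l x x" using l by (rule jsq_exit_rate)
  show "(\<Sum>y\<in>jsq_moves N b x. jsq_rates N b d tie l x y) = 0"
    using jsq_generator[OF tie x d(2), of l "\<lambda>_. 1"] by simp
  have "measure_pmf.expectation (after_arrival N b d tie x) f - f x \<le> \<alpha> x + \<beta> x * frac_at_least N x j ^ d"
    using expectation_after_arrival_le[OF tie x d(2) N f \<beta> arrival[OF x]] .
  then have "l * (measure_pmf.expectation (after_arrival N b d tie x) f - f x)
      \<le> l * (\<alpha> x + \<beta> x * frac_at_least N x j ^ d)" using l by (rule mult_left_mono)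
  then show "(\<Sum>y\<in>jsq_moves N b x. jsq_rates N b d tie l x y * f y) \<le> H (occupancy N b x)"
    unfolding jsq_generator[OF tie x d(2)] using drift[OF x] by linarith
qed (use jsq_moves_basic f H lim in auto)

end

text \<open>
  The quantity \<open>(d + 1) * u ^ d\<close> is at most the geometric sum \<open>1 + u + \<dots> + u ^ d\<close>.
  With \<open>u\<close> the fraction of busy servers, this bounds the only term in which the dispatching scheme
  enters the variance estimate below, uniformly in the state.
\<close>

lemma one_minus_times_power_le:
  fixes u :: real
  assumes "0 \<le> u" "u \<le> 1"
  shows "(1 - u) * u ^ d \<le> 1 / (real d + 1)"
proof -
  have "(real d + 1) * u ^ d = (\<Sum>k<Suc d. u ^ d)" by (simp add: algebra_simps)
  also have "\<dots> \<le> (\<Sum>k<Suc d. u ^ k)"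
    using assms by (intro sum_mono power_decreasing) auto
  finally have "(1 - u) * ((real d + 1) * u ^ d) \<le> (1 - u) * (\<Sum>k<Suc d. u ^ k)"
    using assms by (intro mult_left_mono) auto
  also have "\<dots> = 1 - u ^ Suc d" by (rule one_diff_power_eq[symmetric])
  also have "\<dots> \<le> 1" using assms by simp
  finally show ?thesis by (simp add: field_simps)
qed

context stationary_jsq
begin

lemma support_bounds:
  assumes "z \<in> set_pmf \<rho>"
  shows "0 \<le> z i" "z i \<le> 1" "\<forall>\<^sub>F i in sequentially. z i = 0" "1 \<le> i \<Longrightarrow> i \<le> j \<Longrightarrow> z j \<le> z i"
proof -
  obtain x where x: "x \<in> queue_states N b" and z: "z = occupancy N b x"
    using support[OF assms] by auto
  show "0 \<le> z i" by (simp add: z occupancy_def)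
  show "z i \<le> 1"
    using frac_at_least_le_1[of N x i] by (simp add: z occupancy_def frac_at_least_def)
  show "\<forall>\<^sub>F i in sequentially. z i = 0"
  proof (rule eventually_mono[OF eventually_gt_at_top[of "\<Sum>k<N. x ! k"]])
    fix i assume "(\<Sum>k<N. x ! k) < i"
    moreover have "x ! k \<le> (\<Sum>k<N. x ! k)" if "k < N" for k
      using that by (intro member_le_sum) auto
    ultimately have "{k. k < N \<and> i \<le> x ! k} = {}" by fastforce
    then show "z i = 0" unfolding z occupancy_def by (simp only: card.empty) simp
  qed
  show "z j \<le> z i" if "1 \<le> i" "i \<le> j"
  proof -
    have "card {k. k < N \<and> j \<le> x ! k} \<le> card {k. k < N \<and> i \<le> x ! k}"
      using that by (intro card_mono) auto
    then have "frac_at_least N x j \<le> frac_at_least N x i"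
      by (simp add: frac_at_least_def divide_right_mono)
    then show ?thesis using that by (simp add: z occupancy_eq_frac_at_least[OF x])
  qed
qed

lemma integrable_on_support:
  fixes f :: "(nat \<Rightarrow> real) \<Rightarrow> real"
  assumes "\<And>z. z \<in> set_pmf \<rho> \<Longrightarrow> \<bar>f z\<bar> \<le> B"
  shows "integrable \<rho> f"
  by (rule measure_pmf.integrable_const_bound[where B=B]) (use assms in \<open>auto simp: AE_measure_pmf_iff\<close>)

lemma integrable_coordinate_power: "integrable \<rho> (\<lambda>z. z i ^ n)"
  by (rule integrable_on_support[where B=1]) (use support_bounds in \<open>auto simp: abs_le_iff power_le_one intro: order_trans[OF _ zero_le_power]\<close>)

lemma integrable_coordinate: "integrable \<rho> (\<lambda>z. z i)"
  using integrable_coordinate_power[of i 1] by simp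

text \<open>
  Balance for the number of tasks at positions \<open>a + 1, \<dots>, m\<close> of the queues. It increases only if
  all sampled queues have length at least \<open>a\<close>, and it decreases at rate \<open>N * (z (a + 1) - z (m + 1))\<close>.
  The truncation at \<open>m\<close> keeps the function bounded.
\<close>

lemma truncated_tail_drift:
  assumes "a < m"
  shows "measure_pmf.expectation \<rho> (\<lambda>z. z (Suc a)) \<le>
    l / N * measure_pmf.expectation \<rho> (\<lambda>z. (if a = 0 then 1 else z a) ^ d)
    + measure_pmf.expectation \<rho> (\<lambda>z. z (Suc m))"
proof -
  \<comment> \<open>The tasks of a queue at positions \<open>a + 1, \<dots>, m\<close>, per server.\<close>
  define g where "g n = (real (min n m) - real (min n a)) / N" for n
  define H where "H z = l / N * (if a = 0 then 1 else z a) ^ d - z (Suc a) + z (Suc m)" for z :: "nat \<Rightarrow> real"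
  have g: "0 \<le> g n" "g n \<le> m" for n
  proof -
    show "0 \<le> g n" using assms N by (auto simp: g_def)
    have "g n \<le> real m / N" unfolding g_def using N by (intro divide_right_mono) auto
    also have "\<dots> \<le> real m" using N by (simp add: divide_le_eq mult_left_le_one_le mult_le_cancel_left1)
    finally show "g n \<le> m" .
  qed
  have g_up: "g (n + 1) - g n \<le> 1 / N * of_bool (a \<le> n)" for n
  proof -
    have "real (min (n + 1) m) - real (min (n + 1) a) - (real (min n m) - real (min n a)) \<le> of_bool (a \<le> n)"
      using assms by auto
    then show ?thesis using N by (simp add: g_def divide_simps)
  qed
  have g_down: "g (n - 1) - g n = (of_bool (Suc m \<le> n) - of_bool (Suc a \<le> n)) / N" if "0 < n" for n
  proof -
    have "real (min (n - 1) m) - real (min (n - 1) a) - (real (min n m) - real (min n a))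
        = of_bool (Suc m \<le> n) - of_bool (Suc a \<le> n)"
      using assms that by auto
    then show ?thesis by (simp add: g_def flip: diff_divide_distrib)
  qed
  have "0 \<le> measure_pmf.expectation \<rho> H"
  proof (rule drift_nonneg[where f="\<lambda>x. \<Sum>k<N. g (x ! k)" and \<alpha>="\<lambda>_. 0" and \<beta>="\<lambda>_. 1 / N" and j=a])
    fix y :: "nat list"
    have "(\<Sum>k<N. g (y ! k)) \<le> (\<Sum>k<N. real m)" by (intro sum_mono g)
    then show "\<bar>\<Sum>k<N. g (y ! k)\<bar> \<le> N * m" using g by (simp add: sum_nonneg)
  next
    fix x k assume x: "x \<in> queue_states N b" and k: "k < N"
    then have len: "length x = N" by (simp add: queue_states_def)
    show "(\<Sum>i<N. g ((if enat (x ! k) < b then x[k := x ! k + 1] else x) ! i)) - (\<Sum>i<N. g (x ! i))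
        \<le> 0 + 1 / N * of_bool (a \<le> x ! k)"
    proof (cases "enat (x ! k) < b")
      case True
      then show ?thesis using sum_nth_list_update[OF len k, of g "x ! k + 1"] g_up by simp
    qed simp
  next
    fix x assume x: "x \<in> queue_states N b"
    then have len: "length x = N" by (simp add: queue_states_def)
    have "(\<Sum>k | k < N \<and> 0 < x ! k. (\<Sum>i<N. g (x[k := x ! k - 1] ! i)) - (\<Sum>i<N. g (x ! i)))
        = (\<Sum>k | k < N \<and> 0 < x ! k. (of_bool (Suc m \<le> x ! k) - of_bool (Suc a \<le> x ! k)) / N)"
      using sum_nth_list_update[OF len, of _ g] g_down by (intro sum.cong refl) simp
    also have "\<dots> = (\<Sum>k<N. (of_bool (Suc m \<le> x ! k) - of_bool (Suc a \<le> x ! k)) / N)"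
      by (rule sum.mono_neutral_left) auto
    also have "\<dots> = frac_at_least N x (Suc m) - frac_at_least N x (Suc a)"
      by (simp add: frac_at_least_def sum_subtractf diff_divide_distrib lessThan_def Int_def
          flip: sum_divide_distrib)
    finally show "l * (0 + 1 / N * frac_at_least N x a ^ d) +
        (\<Sum>k | k < N \<and> 0 < x ! k. (\<Sum>i<N. g (x[k := x ! k - 1] ! i)) - (\<Sum>i<N. g (x ! i)))
        \<le> H (occupancy N b x)"
      using x N by (simp add: H_def occupancy_eq_frac_at_least frac_at_least_0)
  next
    fix x assume x: "x \<in> queue_states N b"
    define u where "u = l / N * (if a = 0 then 1 else occupancy N b x a) ^ d"
    have "\<bar>u\<bar> \<le> l / N"
      unfolding u_def
      using l x by (auto simp: abs_mult occupancy_eq_frac_at_least frac_at_least_nonneg frac_at_least_le_1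
          intro!: mult_left_le power_le_one divide_right_mono)
    moreover have "0 \<le> occupancy N b x (Suc i)" "occupancy N b x (Suc i) \<le> 1" for i
      using x by (simp_all add: occupancy_eq_frac_at_least frac_at_least_nonneg frac_at_least_le_1)
    from this[of a] this[of m] calculation show "\<bar>H (occupancy N b x)\<bar> \<le> l / N + 2"
      unfolding H_def u_def[symmetric] by linarith
  qed simp
  moreover have "integrable \<rho> (\<lambda>z. (if a = 0 then 1 else z a) ^ d)"
    using integrable_coordinate_power[of a d] by (cases "a = 0") auto
  ultimately show ?thesis
    unfolding H_def by (simp add: integrable_coordinate)
qed

text \<open>
  An occupancy state vanishes at all large levels, so the truncation term disappears as \<open>m\<close> grows.
\<close>

lemma expectation_Suc_le:
  "measure_pmf.expectation \<rho> (\<lambda>z. z (Suc a)) \<le>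
    l / N * measure_pmf.expectation \<rho> (\<lambda>z. (if a = 0 then 1 else z a) ^ d)"
proof -
  have "(\<lambda>m. measure_pmf.expectation \<rho> (\<lambda>z. z (Suc m))) \<longlonglongrightarrow> measure_pmf.expectation \<rho> (\<lambda>z. 0)"
  proof (rule integral_dominated_convergence[where w="\<lambda>_. 1"])
    show "AE z in \<rho>. (\<lambda>m. z (Suc m)) \<longlonglongrightarrow> 0"
    proof (rule AE_pmfI)
      fix z assume "z \<in> set_pmf \<rho>"
      then have "z \<longlonglongrightarrow> 0" using support_bounds(3) by (intro tendsto_eventually)
      then show "(\<lambda>m. z (Suc m)) \<longlonglongrightarrow> 0" by (rule LIMSEQ_Suc)
    qed
  qed (use support_bounds in \<open>auto simp: AE_measure_pmf_iff\<close>)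
  from tendsto_add[OF tendsto_const this]
  have "(\<lambda>m. l / N * measure_pmf.expectation \<rho> (\<lambda>z. (if a = 0 then 1 else z a) ^ d)
      + measure_pmf.expectation \<rho> (\<lambda>z. z (Suc m)))
    \<longlonglongrightarrow> l / N * measure_pmf.expectation \<rho> (\<lambda>z. (if a = 0 then 1 else z a) ^ d) + 0" by simp
  then have "measure_pmf.expectation \<rho> (\<lambda>z. z (Suc a))
      \<le> l / N * measure_pmf.expectation \<rho> (\<lambda>z. (if a = 0 then 1 else z a) ^ d) + 0"
    by (rule LIMSEQ_le_const) (intro exI[of _ "Suc a"] allI impI truncated_tail_drift Suc_le_lessD)
  then show ?thesis by simp
qed

text \<open>
  As \<open>u ^ d \<le> u\<close> on the unit interval, each level carries at most \<open>l / N\<close> times the mass of the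
  level below. This geometric decay gives the tightness needed for infinite buffers.
\<close>

lemma expectation_le_power:
  "1 \<le> i \<Longrightarrow> measure_pmf.expectation \<rho> (\<lambda>z. z i) \<le> (l / N) ^ i"
proof (induction i rule: dec_induct)
  case base
  then show ?case using expectation_Suc_le[of 0] by simp
next
  case (step i)
  have "measure_pmf.expectation \<rho> (\<lambda>z. z (Suc i)) \<le> l / N * measure_pmf.expectation \<rho> (\<lambda>z. z i ^ d)"
    using expectation_Suc_le[of i] step.hyps by simp
  also have "\<dots> \<le> l / N * measure_pmf.expectation \<rho> (\<lambda>z. z i)"
  proof (intro mult_left_mono integral_mono_AE integrable_coordinate integrable_coordinate_power AE_pmfI)
    fix z assume "z \<in> set_pmf \<rho>"
    then show "z i ^ d \<le> z i"
      using support_bounds(1,2)[of z i] power_decreasing[of 1 d "z i"] d by simp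
  qed (use l in simp)
  also have "\<dots> \<le> l / N * (l / N) ^ i"
    using step.IH l by (intro mult_left_mono) auto
  finally show ?case by simp
qed

text \<open>
  The drift of half the squared idle fraction \<open>v = 1 - z 1\<close>. Arrivals change \<open>v\<close> at rate at most
  \<open>- (l / N) * (1 - z 1 ^ d)\<close>, departures at rate at most \<open>z 1\<close>; multiplication by \<open>v\<close>
  gives the first two terms, and the jumps of size \<open>1 / N\<close> contribute the last one.
\<close>

lemma idle_square_drift:
  "0 \<le> measure_pmf.expectation \<rho>
    (\<lambda>z. (1 - z 1) * (z 1 - l / N) + l / N * ((1 - z 1) * z 1 ^ d) + (l / N + 1) / (2 * real N))"
proof -
  define I where "I x = (\<Sum>k<N. of_bool (x ! k = 0) :: real)" for x :: "nat list"
  define f where "f x = I x ^ 2 / (2 * N ^ 2)" for x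
  have I: "0 \<le> I y" "I y \<le> N" for y
  proof -
    have "I y \<le> (\<Sum>k<N. 1)" unfolding I_def by (rule sum_mono) simp
    then show "I y \<le> N" by simp
  qed (simp add: I_def)
  have NN: "real N > 0" using N by simp
  have I_frac: "I x / N = 1 - frac_at_least N x 1" for x
  proof -
    have "I x = (\<Sum>k<N. 1 - of_bool (1 \<le> x ! k))" unfolding I_def by (intro sum.cong) auto
    also have "\<dots> = real N - real (card {k. k < N \<and> 1 \<le> x ! k})"
      by (simp add: sum_subtractf lessThan_def Int_def)
    finally show ?thesis using NN by (simp add: frac_at_least_def diff_divide_distrib)
  qed
  have update: "I (x[k := v]) = I x + (of_bool (v = 0) - of_bool (x ! k = 0))"
    if "length x = N" "k < N" for x k v
    unfolding I_def using sum_nth_list_update[OF that, of "\<lambda>n. of_bool (n = 0)" v] by simp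
  show ?thesis
  \<comment> \<open>An arrival at an idle server changes \<open>f\<close> by \<open>\<alpha> x\<close>. One at a busy server leaves \<open>f\<close> unchanged,
    and there \<open>\<alpha> x + \<beta> x = 1 / (2 * N\<^sup>2)\<close> is an upper bound.\<close>
  proof (rule drift_nonneg[where f=f and \<alpha>="\<lambda>x. (1 - 2 * I x) / (2 * N ^ 2)" and \<beta>="\<lambda>x. I x / N ^ 2" and j=1])
    fix y :: "nat list"
    have "I y ^ 2 \<le> real N ^ 2" using I by (intro power_mono)
    moreover have "0 < real N ^ 2" using NN by simp
    ultimately have "I y ^ 2 \<le> 2 * real N ^ 2" by linarith
    then show "\<bar>f y\<bar> \<le> 1" using NN by (simp add: f_def divide_simps)
  next
    fix x show "0 \<le> I x / N ^ 2" using I by simp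
  next
    fix x k assume x: "x \<in> queue_states N b" and k: "k < N"
    then have len: "length x = N" by (simp add: queue_states_def)
    show "f (if enat (x ! k) < b then x[k := x ! k + 1] else x) - f x
        \<le> (1 - 2 * I x) / (2 * N ^ 2) + I x / N ^ 2 * of_bool (1 \<le> x ! k)"
    proof (cases "x ! k = 0")
      case True
      then have "enat (x ! k) < b" using b by (auto simp: zero_enat_def[symmetric])
      then have "f (if enat (x ! k) < b then x[k := x ! k + 1] else x) = (I x - 1)^2 / (2 * N ^ 2)"
        using True update[OF len k] by (simp add: f_def)
      then show ?thesis using True NN by (simp add: f_def power2_diff diff_divide_distrib add_divide_distrib)
    next
      case False
      then have "f (if enat (x ! k) < b then x[k := x ! k + 1] else x) = f x"
        using update[OF len k] by (simp add: f_def)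
      then show ?thesis using False NN by (simp add: field_simps)
    qed
  next
    fix x assume x: "x \<in> queue_states N b"
    then have len: "length x = N" by (simp add: queue_states_def)
    let ?q = "frac_at_least N x 1"
    have "(\<Sum>k | k < N \<and> 0 < x ! k. f (x[k := x ! k - 1]) - f x)
        \<le> (\<Sum>k | k < N \<and> 0 < x ! k. (2 * I x + 1) / (2 * N ^ 2))"
    proof (rule sum_mono)
      fix k assume "k \<in> {k. k < N \<and> 0 < x ! k}"
      then have k: "k < N" "0 < x ! k" by auto
      have "f (x[k := x ! k - 1]) \<le> (I x + 1) ^ 2 / (2 * N ^ 2)"
        unfolding f_def using k I(1)[of x] by (intro divide_right_mono power_mono) (auto simp: update[OF len k(1)])
      then show "f (x[k := x ! k - 1]) - f x \<le> (2 * I x + 1) / (2 * N ^ 2)"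
        by (simp add: f_def power2_sum add_divide_distrib)
    qed
    also have "\<dots> = ?q * (I x / N) + ?q / (2 * real N)"
      using NN by (simp add: frac_at_least_def Suc_le_eq power2_eq_square field_simps)
    also have "\<dots> \<le> ?q * (I x / N) + 1 / (2 * real N)"
      using frac_at_least_le_1[of N x 1] by (intro add_left_mono divide_right_mono) auto
    also have "\<dots> = ?q * (1 - ?q) + 1 / (2 * real N)"
      by (simp only: I_frac)
    finally have dep: "(\<Sum>k | k < N \<and> 0 < x ! k. f (x[k := x ! k - 1]) - f x) \<le> ?q * (1 - ?q) + 1 / (2 * real N)" .
    have "l * ((1 - 2 * I x) / (2 * N ^ 2) + I x / N ^ 2 * ?q ^ d)
        = l / N * (1 / (2 * real N) - I x / N + I x / N * ?q ^ d)"
      using NN by (simp add: field_simps power2_eq_square)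
    with dep show "l * ((1 - 2 * I x) / (2 * N ^ 2) + I x / N ^ 2 * ?q ^ d) +
        (\<Sum>k | k < N \<and> 0 < x ! k. f (x[k := x ! k - 1]) - f x)
        \<le> (1 - occupancy N b x 1) * (occupancy N b x 1 - l / N) +
          l / N * ((1 - occupancy N b x 1) * occupancy N b x 1 ^ d) + (l / N + 1) / (2 * real N)"
      unfolding I_frac using x by (simp add: occupancy_eq_frac_at_least algebra_simps add_divide_distrib)
  next
    fix x assume x: "x \<in> queue_states N b"
    define q where "q = occupancy N b x 1"
    have q: "0 \<le> q" "q \<le> 1"
      using x by (simp_all add: q_def occupancy_eq_frac_at_least frac_at_least_nonneg frac_at_least_le_1)
    have "0 \<le> l / N" using l by simp
    then have "\<bar>q - l / N\<bar> \<le> 1 + l / N" using q by linarith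
    then have "\<bar>(1 - q) * (q - l / N)\<bar> \<le> 1 * (1 + l / N)"
      unfolding abs_mult using q by (intro mult_mono) auto
    moreover have "\<bar>(1 - q) * q ^ d\<bar> \<le> 1 * 1"
      unfolding abs_mult using q by (intro mult_mono) (auto simp: power_le_one)
    then have "l / N * \<bar>(1 - q) * q ^ d\<bar> \<le> l / N * 1"
      using l by (intro mult_left_mono) auto
    then have "\<bar>l / N * ((1 - q) * q ^ d)\<bar> \<le> l / N" using l by (simp add: abs_mult)
    ultimately show "\<bar>(1 - occupancy N b x 1) * (occupancy N b x 1 - l / N) +
          l / N * ((1 - occupancy N b x 1) * occupancy N b x 1 ^ d) + (l / N + 1) / (2 * real N)\<bar>
        \<le> 1 * (1 + l / N) + l / N + (l / N + 1) / (2 * real N)"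
      unfolding q_def[symmetric] using l by (intro order_trans[OF abs_triangle_ineq] add_mono) auto
  qed
qed

text \<open>
  The linear term in the expansion of the drift has nonpositive expectation, since the mean busy
  fraction is at most \<open>l / N\<close>. What remains is the variance, which is thus bounded by the terms
  that vanish as \<open>d\<close> and \<open>N\<close> grow.
\<close>

lemma busy_fraction_variance:
  assumes "l \<le> N"
  shows "measure_pmf.expectation \<rho> (\<lambda>z. (z 1 - l / N)\<^sup>2) \<le> l / N / (real d + 1) + (l / N + 1) / (2 * real N)"
proof -
  define r where "r = l / N"
  have r: "0 \<le> r" "r \<le> 1" using l N assms by (auto simp: r_def)
  let ?c = "r / (real d + 1) + (r + 1) / (2 * real N)"
  have int_sq: "integrable \<rho> (\<lambda>z. (z 1 - r)\<^sup>2)"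
  proof (rule integrable_on_support)
    fix z assume "z \<in> set_pmf \<rho>"
    then have "\<bar>z 1 - r\<bar> \<le> 1" using support_bounds(1,2)[of z 1] r by auto
    then show "\<bar>(z 1 - r)\<^sup>2\<bar> \<le> 1" by (simp add: abs_square_le_1)
  qed
  have "0 \<le> measure_pmf.expectation \<rho>
    (\<lambda>z. (1 - z 1) * (z 1 - r) + r * ((1 - z 1) * z 1 ^ d) + (r + 1) / (2 * real N))"
    using idle_square_drift by (simp only: r_def)
  also have "\<dots> \<le> measure_pmf.expectation \<rho> (\<lambda>z. (1 - r) * (z 1 - r) - (z 1 - r)\<^sup>2 + ?c)"
  proof (rule integral_mono_AE)
    show "integrable \<rho> (\<lambda>z. (1 - z 1) * (z 1 - r) + r * ((1 - z 1) * z 1 ^ d) + (r + 1) / (2 * real N))"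
      using integrable_coordinate_power[of 1 "Suc d"] integrable_coordinate_power[of 1 d]
        integrable_coordinate_power[of 1 2] integrable_coordinate[of 1]
      by (simp add: algebra_simps power2_eq_square)
    show "integrable \<rho> (\<lambda>z. (1 - r) * (z 1 - r) - (z 1 - r)\<^sup>2 + ?c)"
      using int_sq integrable_coordinate[of 1] by simp
    show "AE z in \<rho>. (1 - z 1) * (z 1 - r) + r * ((1 - z 1) * z 1 ^ d) + (r + 1) / (2 * real N)
        \<le> (1 - r) * (z 1 - r) - (z 1 - r)\<^sup>2 + ?c"
    proof (rule AE_pmfI)
      fix z assume "z \<in> set_pmf \<rho>"
      then have "r * ((1 - z 1) * z 1 ^ d) \<le> r * (1 / (real d + 1))"
        using support_bounds(1,2) r by (intro mult_left_mono one_minus_times_power_le)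
      \<comment> \<open>Expanding \<open>1 - z 1\<close> around \<open>1 - r\<close> produces the variance.\<close>
      moreover have "(1 - z 1) * (z 1 - r) = (1 - r) * (z 1 - r) - (z 1 - r)\<^sup>2"
        by (simp add: power2_eq_square algebra_simps)
      ultimately show "(1 - z 1) * (z 1 - r) + r * ((1 - z 1) * z 1 ^ d) + (r + 1) / (2 * real N)
        \<le> (1 - r) * (z 1 - r) - (z 1 - r)\<^sup>2 + ?c" by simp
    qed
  qed
  also have "\<dots> = (1 - r) * (measure_pmf.expectation \<rho> (\<lambda>z. z 1) - r)
      - measure_pmf.expectation \<rho> (\<lambda>z. (z 1 - r)\<^sup>2) + ?c"
    using int_sq integrable_coordinate[of 1] by simp
  also have "(1 - r) * (measure_pmf.expectation \<rho> (\<lambda>z. z 1) - r) \<le> 0"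
    using expectation_le_power[of 1] r by (intro mult_nonneg_nonpos) (auto simp: r_def)
  finally show ?thesis by (simp add: r_def)
qed

end

lemma abs_expectation_le_sqrt:
  fixes f :: "'a \<Rightarrow> real"
  assumes "integrable (measure_pmf p) f" "integrable (measure_pmf p) (\<lambda>x. (f x)\<^sup>2)"
    and "measure_pmf.expectation p (\<lambda>x. (f x)\<^sup>2) \<le> v"
  shows "measure_pmf.expectation p (\<lambda>x. \<bar>f x\<bar>) \<le> sqrt v"
proof (rule real_le_rsqrt)
  have "(measure_pmf.expectation p (\<lambda>x. \<bar>f x\<bar>))\<^sup>2 \<le> measure_pmf.expectation p (\<lambda>x. \<bar>f x\<bar>\<^sup>2)"
    using measure_pmf.variance_positive[of p "\<lambda>x. \<bar>f x\<bar>"] assms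
    by (subst (asm) measure_pmf.variance_eq) auto
  with assms(3) show "(measure_pmf.expectation p (\<lambda>x. \<bar>f x\<bar>))\<^sup>2 \<le> v" by simp
qed

context stationary_jsq
begin

lemma integrable_square_deviation: "integrable \<rho> (\<lambda>z. (z i - c)\<^sup>2)"
proof (rule integrable_on_support)
  fix z assume "z \<in> set_pmf \<rho>"
  then have "\<bar>z i - c\<bar> \<le> 1 + \<bar>c\<bar>" using support_bounds(1,2)[of z i] by auto
  then have "\<bar>z i - c\<bar>\<^sup>2 \<le> (1 + \<bar>c\<bar>)\<^sup>2" by (intro power_mono) auto
  then show "\<bar>(z i - c)\<^sup>2\<bar> \<le> (1 + \<bar>c\<bar>)\<^sup>2" by simp
qed

text \<open>
  Either the busy fraction is at most \<open>c\<close>, or it deviates from \<open>l / N\<close> by at least \<open>c - r\<close>; the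
  latter is controlled by Chebyshev's inequality.
\<close>

lemma expectation_busy_power_le:
  assumes "l / N \<le> r" "r < c"
  shows "measure_pmf.expectation \<rho> (\<lambda>z. z 1 ^ d)
    \<le> c ^ d + measure_pmf.expectation \<rho> (\<lambda>z. (z 1 - l / N)\<^sup>2) / (c - r)\<^sup>2"
proof -
  have "0 \<le> l / N" using l by simp
  with assms have c: "0 < c" by linarith
  have "measure_pmf.expectation \<rho> (\<lambda>z. z 1 ^ d)
      \<le> measure_pmf.expectation \<rho> (\<lambda>z. c ^ d + (z 1 - l / N)\<^sup>2 / (c - r)\<^sup>2)"
  proof (rule integral_mono_AE)
    show "AE z in \<rho>. z 1 ^ d \<le> c ^ d + (z 1 - l / N)\<^sup>2 / (c - r)\<^sup>2"
    proof (rule AE_pmfI)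
      fix z assume z: "z \<in> set_pmf \<rho>"
      show "z 1 ^ d \<le> c ^ d + (z 1 - l / N)\<^sup>2 / (c - r)\<^sup>2"
      proof (cases "z 1 \<le> c")
        case True
        then have "z 1 ^ d \<le> c ^ d" using support_bounds(1)[OF z] by (rule power_mono)
        then show ?thesis by (simp add: add_increasing2)
      next
        case False
        then have "(c - r)\<^sup>2 \<le> (z 1 - l / N)\<^sup>2" using assms by (intro power_mono) auto
        then have "1 \<le> (z 1 - l / N)\<^sup>2 / (c - r)\<^sup>2" using assms by simp
        moreover have "z 1 ^ d \<le> 1" using support_bounds(1,2)[OF z] by (intro power_le_one)
        moreover have "0 \<le> c ^ d" using c by simp
        ultimately show ?thesis by linarith
      qed
    qed
  qed (use integrable_coordinate_power integrable_square_deviation in auto)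
  then show ?thesis by (simp add: integrable_square_deviation)
qed

text \<open>
  Markov's inequality, with the expectation of the distance computed coordinate by coordinate.
\<close>

lemma prob_l1_dist_ge_le:
  assumes p: "p \<in> occ_space b" and \<delta>: "0 < \<delta>"
    and sm: "summable (\<lambda>i. measure_pmf.expectation \<rho> (\<lambda>z. \<bar>z i - p i\<bar>))"
  shows "measure \<rho> {z. \<delta> \<le> l1_dist z p} \<le> (\<Sum>i. measure_pmf.expectation \<rho> (\<lambda>z. \<bar>z i - p i\<bar>)) / \<delta>"
proof -
  have int: "integrable \<rho> (\<lambda>z. \<bar>z i - p i\<bar>)" for i
    using integrable_coordinate[of i] by auto
  have sums: "(\<lambda>i. \<bar>z i - p i\<bar>) sums l1_dist z p" if "z \<in> set_pmf \<rho>" for z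
  proof -
    have "z \<in> occ_space b" using support[OF that] occupancy_in_occ_space by auto
    then have "(\<lambda>i. \<bar>z i - p i\<bar>) summable_on UNIV" using p by (rule occ_space_diff_summable)
    then show ?thesis unfolding l1_dist_def by (intro has_sum_imp_sums has_sum_infsum)
  qed
  have dist_eq: "l1_dist z p = (\<Sum>i. \<bar>z i - p i\<bar>)" if "z \<in> set_pmf \<rho>" for z
    using sums[OF that] by (rule sums_unique)
  have AE_sm: "AE z in \<rho>. summable (\<lambda>i. norm \<bar>z i - p i\<bar>)"
    using sums by (auto simp: AE_measure_pmf_iff dest: sums_summable)
  have sm': "summable (\<lambda>i. measure_pmf.expectation \<rho> (\<lambda>z. norm \<bar>z i - p i\<bar>))" using sm by simp
  note int_suminf = integrable_suminf[OF int AE_sm sm'] and eq = integral_suminf[OF int AE_sm sm']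
  have "measure \<rho> {z. \<delta> \<le> l1_dist z p} = measure \<rho> {z \<in> space \<rho>. \<delta> \<le> (\<Sum>i. \<bar>z i - p i\<bar>)}"
    by (intro measure_pmf.finite_measure_eq_AE) (auto simp: AE_measure_pmf_iff dist_eq)
  also have "\<dots> \<le> measure_pmf.expectation \<rho> (\<lambda>z. \<Sum>i. \<bar>z i - p i\<bar>) / \<delta>"
    using sums \<delta> by (intro integral_Markov_inequality_measure[where A="UNIV"] int_suminf)
      (auto simp: AE_measure_pmf_iff intro!: suminf_nonneg dest: sums_summable)
  finally show ?thesis by (simp only: eq)
qed

end

section \<open>Weak convergence to a Dirac measure\<close>

lemma sets_borel_on_open: "openin T U \<Longrightarrow> U \<in> sets (borel_on T)"
  unfolding borel_on_def by (subst sets_measure_of) (auto dest: openin_subset)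

lemma space_borel_on: "space (borel_on T) = topspace T"
  by (simp add: borel_on_def space_measure_of_conv)

lemma borel_measurable_continuous_map:
  assumes "continuous_map T euclideanreal f"
  shows "f \<in> borel_measurable (borel_on T)"
proof (rule borel_measurableI)
  fix S :: "real set" assume "open S"
  then have "openin T {x \<in> topspace T. f x \<in> S}"
    using assms openin_continuous_map_preimage by fastforce
  then have "{x \<in> topspace T. f x \<in> S} \<in> sets (borel_on T)" by (rule sets_borel_on_open)
  moreover have "f -` S \<inter> space (borel_on T) = {x \<in> topspace T. f x \<in> S}"
    by (auto simp: space_borel_on)
  ultimately show "f -` S \<inter> space (borel_on T) \<in> sets (borel_on T)" by simp
qed

lemma singleton_in_sets_occ:
  assumes "q \<in> occ_space b"
  shows "{q} \<in> sets (borel_on (occ_topology b))"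
proof -
  have "Hausdorff_space (occ_topology b)"
    unfolding occ_topology_def by (rule Metric_space.Hausdorff_space_mtopology[OF Metric_space_occ])
  then have "closedin (occ_topology b) {q}"
    using assms by (intro closedin_Hausdorff_singleton) auto
  then have "occ_space b - {q} \<in> sets (borel_on (occ_topology b))"
    by (intro sets_borel_on_open) (simp add: closedin_def)
  then have "space (borel_on (occ_topology b)) - (occ_space b - {q}) \<in> sets (borel_on (occ_topology b))"
    by (rule sets.compl_sets)
  moreover have "space (borel_on (occ_topology b)) - (occ_space b - {q}) = {q}"
    using assms by (auto simp: space_borel_on)
  ultimately show ?thesis by simp
qed

text \<open>
  The stationary measure lives on a Borel \<sigma>-algebra, but it is carried by the countable set of
  occupancy states, so integrals against it are expectations under a mass function \<open>\<rho>\<close>.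
\<close>

lemma stationary_measure_pmf:
  assumes stat: "is_stationary_measure N b M X \<pi>"
    and X: "\<And>t \<omega>. 0 \<le> t \<Longrightarrow> \<omega> \<in> space M \<Longrightarrow> X t \<omega> \<in> queue_states N b"
  shows "\<exists>\<rho>. (\<forall>z. ((\<lambda>t. measure M {\<omega>\<in>space M. occupancy N b (X t \<omega>) = z}) \<longlongrightarrow> pmf \<rho> z) at_top) \<and>
    (\<forall>f. f \<in> borel_measurable (borel_on (occ_topology b)) \<longrightarrow>
       integral\<^sup>L \<pi> f = measure_pmf.expectation \<rho> (f :: _ \<Rightarrow> real))"
proof -
  let ?C = "occupancy N b ` queue_states N b"
  interpret \<pi>: prob_space \<pi> using stat by (simp add: is_stationary_measure_def)
  have sets_eq: "sets \<pi> = sets (borel_on (occ_topology b))"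
    and C1: "measure \<pi> ?C = 1"
    and lim: "\<And>q. q \<in> occ_space b \<Longrightarrow>
      ((\<lambda>t. measure M {\<omega>\<in>space M. occupancy N b (X t \<omega>) = q}) \<longlongrightarrow> measure \<pi> {q}) at_top"
    using stat by (auto simp: is_stationary_measure_def)
  have space_eq: "space \<pi> = occ_space b"
    using sets_eq_imp_space_eq[OF sets_eq] by (simp add: space_borel_on)
  have C: "countable ?C" "?C \<subseteq> occ_space b"
    using occupancy_in_occ_space by (auto intro: countable_image countableI_type)
  have sing: "{q} \<in> sets \<pi>" if "q \<in> occ_space b" for q
    using singleton_in_sets_occ[OF that] by (simp add: sets_eq)
  have C_sets: "?C \<in> sets \<pi>"
    by (rule sets.countable[OF sing C(1)]) (use C(2) in blast)
  have AE_C: "AE q in \<pi>. q \<in> ?C" using C1 \<pi>.prob_eq_1[OF C_sets] by blast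
  have "?C \<noteq> {}" using C1 by (metis measure_empty zero_neq_one)
  then obtain c where c: "c \<in> ?C" by blast
  \<comment> \<open>Almost surely the identity, but with countable range.\<close>
  define Y where "Y q = (if q \<in> ?C then q else c)" for q
  have Y_C: "Y q \<in> ?C" for q using c by (auto simp: Y_def)
  have Y: "Y \<in> measurable \<pi> (count_space ?C)"
    unfolding measurable_count_space_eq_countable[OF C(1)]
  proof (intro conjI ballI)
    show "Y \<in> space \<pi> \<rightarrow> ?C" using Y_C by blast
    fix a assume a: "a \<in> ?C"
    have "Y -` {a} \<inter> space \<pi> = (if a = c then (space \<pi> - ?C) \<union> {c} else {a})"
      using a c C(2) by (auto simp: Y_def space_eq split: if_splits)
    moreover have "{a} \<in> sets \<pi>" "{c} \<in> sets \<pi>" using a c C(2) by (auto intro!: sing)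
    then have "(space \<pi> - ?C) \<union> {c} \<in> sets \<pi>" by (intro sets.Un sets.compl_sets C_sets)
    ultimately show "Y -` {a} \<inter> space \<pi> \<in> sets \<pi>"
      using \<open>{a} \<in> sets \<pi>\<close> by (cases "a = c") (simp_all only: if_True if_False refl)
  qed
  have Y': "Y \<in> measurable \<pi> (count_space UNIV)" using Y by (rule measurable_compose) simp
  from countable_valued_law_pmf[OF \<pi>.prob_space_axioms Y C(1)]
  obtain \<rho> where \<rho>: "measure_pmf \<rho> = distr \<pi> (count_space UNIV) Y" by blast
  have AE_Y: "AE q in \<pi>. Y q = q" using AE_C by eventually_elim (simp add: Y_def)
  have pmf_\<rho>: "pmf \<rho> z = measure \<pi> (Y -` {z} \<inter> space \<pi>)" for z
    by (simp add: measure_pmf_single[symmetric] \<rho> measure_distr[OF Y'])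
  have "((\<lambda>t. measure M {\<omega>\<in>space M. occupancy N b (X t \<omega>) = z}) \<longlongrightarrow> pmf \<rho> z) at_top" for z
  proof (cases "z \<in> occ_space b")
    case True
    have "pmf \<rho> z = measure \<pi> {z}"
      unfolding pmf_\<rho>
    proof (rule \<pi>.finite_measure_eq_AE)
      show "AE q in \<pi>. q \<in> Y -` {z} \<inter> space \<pi> \<longleftrightarrow> q \<in> {z}"
        using AE_Y AE_space[of \<pi>] by eventually_elim auto
    qed (use measurable_sets[OF Y', of "{z}"] sing[OF True] in auto)
    then show ?thesis using lim[OF True] by simp
  next
    case False
    then have "Y -` {z} \<inter> space \<pi> = {}" using Y_C C(2) by blast
    then have "pmf \<rho> z = 0" by (simp only: pmf_\<rho> measure_empty)
    moreover have "measure M {\<omega>\<in>space M. occupancy N b (X t \<omega>) = z} = 0" if "t \<ge> 0" for t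
    proof -
      have "{\<omega>\<in>space M. occupancy N b (X t \<omega>) = z} = {}"
        using X[OF that] False occupancy_in_occ_space by blast
      then show ?thesis by (simp only: measure_empty)
    qed
    then have "\<forall>\<^sub>F t in at_top. measure M {\<omega>\<in>space M. occupancy N b (X t \<omega>) = z} = 0"
      by (intro eventually_mono[OF eventually_ge_at_top[of 0]])
    ultimately show ?thesis by (simp add: tendsto_eventually)
  qed
  moreover have "integral\<^sup>L \<pi> f = measure_pmf.expectation \<rho> f"
    if f: "f \<in> borel_measurable (borel_on (occ_topology b))" for f :: "(nat \<Rightarrow> real) \<Rightarrow> real"
  proof -
    have [measurable]: "f \<in> borel_measurable \<pi>"
      using f by (simp add: measurable_cong_sets[OF sets_eq refl])
    have "measure_pmf.expectation \<rho> f = (\<integral>q. f (Y q) \<partial>\<pi>)"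
      unfolding \<rho> by (rule integral_distr[OF Y']) simp
    also have "\<dots> = (\<integral>q. f q \<partial>\<pi>)"
    proof (rule integral_cong_AE)
      show "(\<lambda>q. f (Y q)) \<in> borel_measurable \<pi>"
        using Y' by (rule measurable_compose) simp
      show "AE q in \<pi>. f (Y q) = f q" using AE_Y by eventually_elim simp
    qed simp
    finally show ?thesis by simp
  qed
  ultimately show ?thesis by blast
qed

text \<open>
  A continuous test function is nearly constant on a small ball around \<open>p\<close> and bounded elsewhere,
  so concentration in probability around \<open>p\<close> suffices.
\<close>

lemma weakly_converges_occ_dirac:
  assumes p: "p \<in> occ_space b"
    and law: "\<forall>\<^sub>F N in sequentially. set_pmf (\<rho> N) \<subseteq> occ_space b \<and>
      (\<forall>f. f \<in> borel_measurable (borel_on (occ_topology b)) \<longrightarrow>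
        integral\<^sup>L (\<pi> N) f = measure_pmf.expectation (\<rho> N) (f :: _ \<Rightarrow> real))"
    and conc: "\<And>\<delta>. 0 < \<delta> \<Longrightarrow> (\<lambda>N. measure (\<rho> N) {z. \<delta> \<le> l1_dist z p}) \<longlonglongrightarrow> 0"
  shows "weakly_converges (occ_topology b) \<pi> (return (borel_on (occ_topology b)) p)"
  unfolding weakly_converges_def
proof (intro allI impI)
  fix f :: "(nat \<Rightarrow> real) \<Rightarrow> real"
  assume cont: "continuous_map (occ_topology b) euclideanreal f"
    and bdd: "bounded (f ` topspace (occ_topology b))"
  note meas = borel_measurable_continuous_map[OF cont]
  obtain B where B: "\<And>z. z \<in> occ_space b \<Longrightarrow> \<bar>f z\<bar> \<le> B"
    using bdd by (auto simp: bounded_iff)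
  have B0: "0 \<le> B" using B[OF p] by linarith
  have "integral\<^sup>L (return (borel_on (occ_topology b)) p) f = f p"
    using p meas by (intro integral_return) (auto simp: space_borel_on)
  moreover have "(\<lambda>N. integral\<^sup>L (\<pi> N) f) \<longlonglongrightarrow> f p"
  proof (rule LIMSEQ_I, goal_cases)
    case (1 e)
    define U where "U = {x \<in> occ_space b. f x \<in> ball (f p) (e / 2)}"
    have "openin (occ_topology b) U"
      unfolding U_def using openin_continuous_map_preimage[OF cont, of "ball (f p) (e / 2)"] by simp
    moreover have "p \<in> U" using p 1 by (simp add: U_def)
    ultimately obtain \<delta> where \<delta>: "\<delta> > 0" "Metric_space.mball (occ_space b) l1_dist p \<delta> \<subseteq> U"
      unfolding occ_topology_def Metric_space.openin_mtopology[OF Metric_space_occ] by blast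
    have near: "\<bar>f z - f p\<bar> < e / 2" if "z \<in> occ_space b" "l1_dist z p < \<delta>" for z
    proof -
      have "z \<in> U" using \<delta>(2) that p Metric_space.commute[OF Metric_space_occ, of z p]
        by (auto simp: Metric_space.in_mball[OF Metric_space_occ])
      then show ?thesis by (simp add: U_def dist_real_def abs_minus_commute)
    qed
    have "\<forall>\<^sub>F N in sequentially. measure (\<rho> N) {z. \<delta> \<le> l1_dist z p} < e / (2 * (2 * B + 1))"
      using 1 B0 by (intro order_tendstoD(2)[OF conc[OF \<delta>(1)]]) auto
    with law have "\<forall>\<^sub>F N in sequentially. norm (integral\<^sup>L (\<pi> N) f - f p) < e"
    proof eventually_elim
      case (elim N)
      let ?far = "{z. \<delta> \<le> l1_dist z p}"
      have int: "integrable (\<rho> N) f"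
        by (rule measure_pmf.integrable_const_bound[where B=B]) (use elim B in \<open>auto simp: AE_measure_pmf_iff\<close>)
      have "integral\<^sup>L (\<pi> N) f - f p = measure_pmf.expectation (\<rho> N) (\<lambda>z. f z - f p)"
        using elim meas int by simp
      also have "\<bar>\<dots>\<bar> \<le> measure_pmf.expectation (\<rho> N) (\<lambda>z. \<bar>f z - f p\<bar>)"
        by (rule integral_abs_bound)
      also have "\<dots> \<le> measure_pmf.expectation (\<rho> N) (\<lambda>z. e / 2 + 2 * B * indicator ?far z)"
      proof (rule integral_mono_AE)
        show "AE z in \<rho> N. \<bar>f z - f p\<bar> \<le> e / 2 + 2 * B * indicator ?far z"
        proof (rule AE_pmfI)
          fix z assume "z \<in> set_pmf (\<rho> N)"
          then have z: "z \<in> occ_space b" using elim by auto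
          show "\<bar>f z - f p\<bar> \<le> e / 2 + 2 * B * indicator ?far z"
            using near[OF z] B[OF z] B[OF p] 1 by (cases "z \<in> ?far") auto
        qed
        show "integrable (\<rho> N) (\<lambda>z. e / 2 + 2 * B * indicator ?far z)"
          by (rule integrable_pmf_bounded[where B="e / 2 + 2 * B"]) (use 1 B0 in \<open>auto simp: indicator_def\<close>)
      qed (use int in auto)
      also have "\<dots> = e / 2 + 2 * B * measure (\<rho> N) ?far"
        by (simp add: integrable_pmf_bounded[where B=1])
      also have "2 * B * measure (\<rho> N) ?far \<le> (2 * B + 1) * measure (\<rho> N) ?far"
        by (intro mult_right_mono) auto
      also have "\<dots> < e / 2"
        using elim B0 by (simp add: field_simps)
      finally show ?case by simp
    qed
    then show ?case by (simp add: eventually_sequentially)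
  qed
  ultimately show "(\<lambda>N. integral\<^sup>L (\<pi> N) f) \<longlonglongrightarrow> integral\<^sup>L (return (borel_on (occ_topology b)) p) f"
    by simp
qed

section \<open>Convergence of the stationary measures\<close>

text \<open>
  Each coordinate converges in mean: level 1 by the variance bound, and the higher levels because
  they are dominated by level 2, which is fed only by arrivals that find all sampled servers busy.
  The geometric decay of the levels is a summable bound that is uniform in \<open>N\<close>, so Tannery's
  theorem exchanges the limit with the sum over the levels.
\<close>

lemma stationary_deviation_tendsto_0:
  assumes l01: "0 \<le> l" "l < 1"
    and load: "(\<lambda>N. lam N / real N) \<longlonglongrightarrow> l"
    and d: "filterlim d at_top sequentially"
    and stat: "\<forall>\<^sub>F N in sequentially. stationary_jsq N b (d N) (tie N) (lam N) (M N) (X N) (\<rho> N)"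
  shows "\<forall>\<^sub>F N in sequentially. summable (\<lambda>i. measure_pmf.expectation (\<rho> N) (\<lambda>z. \<bar>z i - q_star l i\<bar>))"
    and "(\<lambda>N. \<Sum>i. measure_pmf.expectation (\<rho> N) (\<lambda>z. \<bar>z i - q_star l i\<bar>)) \<longlonglongrightarrow> 0"
proof -
  \<comment> \<open>Room between the limiting load and full utilisation: \<open>l < r < c < 1\<close>.\<close>
  define r where "r = (l + 1) / 2"
  define c where "c = (r + 1) / 2"
  have r: "0 < r" "l < r" "r < c" "c < 1" using l01 by (auto simp: r_def c_def)
  let ?e = "\<lambda>i N. measure_pmf.expectation (\<rho> N) (\<lambda>z. \<bar>z i - q_star l i\<bar>)"
  define v where "v N = lam N / N / (real (d N) + 1) + (lam N / N + 1) / (2 * real N)" for N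
  have "\<forall>\<^sub>F N in sequentially. lam N / N < r" by (rule order_tendstoD(2)[OF load r(2)])
  with stat have good: "\<forall>\<^sub>F N in sequentially.
      stationary_jsq N b (d N) (tie N) (lam N) (M N) (X N) (\<rho> N) \<and> 0 \<le> lam N / N \<and> lam N / N \<le> r \<and> lam N \<le> N"
  proof eventually_elim
    case (elim N)
    then interpret stationary_jsq N b "d N" "tie N" "lam N" "M N" "X N" "\<rho> N" by simp
    have "lam N / N \<le> 1" using elim(2) r by linarith
    then have "lam N \<le> N" using N by (simp add: divide_le_eq)
    moreover have "0 \<le> lam N / N" using l by simp
    moreover have "lam N / N \<le> r" using elim(2) by (rule less_imp_le)
    ultimately show ?case using elim(1) by blast
  qed
  have variance: "measure_pmf.expectation (\<rho> N) (\<lambda>z. (z 1 - lam N / N)\<^sup>2) \<le> v N"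
    if "stationary_jsq N b (d N) (tie N) (lam N) (M N) (X N) (\<rho> N) \<and> 0 \<le> lam N / N \<and> lam N / N \<le> r \<and> lam N \<le> N" for N
  proof -
    interpret stationary_jsq N b "d N" "tie N" "lam N" "M N" "X N" "\<rho> N" using that by blast
    have "lam N \<le> N" using that by blast
    then show ?thesis unfolding v_def by (rule busy_fraction_variance)
  qed
  have d_real: "filterlim (\<lambda>N. real (d N) + 1) at_top sequentially"
    using d by (intro filterlim_tendsto_add_at_top[OF _ filterlim_compose[OF filterlim_real_sequentially d], of "\<lambda>_. 1" 1, unfolded add.commute[of 1]]) auto
  have "v \<longlonglongrightarrow> 0 + 0"
    unfolding v_def
    by (intro tendsto_add tendsto_divide_0[OF load] tendsto_divide_0[OF tendsto_add[OF load tendsto_const]]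
        filterlim_at_top_imp_at_infinity d_real filterlim_tendsto_pos_mult_at_top[OF tendsto_const] filterlim_real_sequentially) auto
  then have v: "v \<longlonglongrightarrow> 0" by simp
  have c_pow: "(\<lambda>N. c ^ d N) \<longlonglongrightarrow> 0"
    using r by (intro filterlim_compose[OF LIMSEQ_power_zero d]) auto
  have lim: "?e i \<longlonglongrightarrow> 0" for i
  proof -
    consider "i = 0" | "i = 1" | "i \<ge> 2" by linarith
    then show ?thesis
    proof cases
      case 1
      have "\<forall>\<^sub>F N in sequentially. ?e i N = 0" using good
      proof eventually_elim
        case (elim N)
        then interpret stationary_jsq N b "d N" "tie N" "lam N" "M N" "X N" "\<rho> N" by simp
        have "AE z in \<rho> N. \<bar>z i - q_star l i\<bar> = 0"
        proof (rule AE_pmfI)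
          fix z assume "z \<in> set_pmf (\<rho> N)"
          then show "\<bar>z i - q_star l i\<bar> = 0"
            using support 1 by (fastforce simp: occupancy_def levels_def q_star_def)
        qed
        then have "?e i N = measure_pmf.expectation (\<rho> N) (\<lambda>z. 0)" by (intro integral_cong_AE) auto
        then show ?case by simp
      qed
      then show ?thesis by (rule tendsto_eventually)
    next
      case 2
      have "\<forall>\<^sub>F N in sequentially. ?e i N \<le> sqrt (v N) + \<bar>lam N / N - l\<bar>" using good
      proof eventually_elim
        case (elim N)
        then interpret stationary_jsq N b "d N" "tie N" "lam N" "M N" "X N" "\<rho> N" by simp
        have "?e i N \<le> measure_pmf.expectation (\<rho> N) (\<lambda>z. \<bar>z 1 - lam N / N\<bar> + \<bar>lam N / N - l\<bar>)"
          using integrable_coordinate[of 1] by (intro integral_mono) (auto simp: 2 q_star_def)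
        also have "\<dots> = measure_pmf.expectation (\<rho> N) (\<lambda>z. \<bar>z 1 - lam N / N\<bar>) + \<bar>lam N / N - l\<bar>"
          using integrable_coordinate[of 1] by simp
        also have "measure_pmf.expectation (\<rho> N) (\<lambda>z. \<bar>z 1 - lam N / N\<bar>) \<le> sqrt (v N)"
          using integrable_coordinate[of 1] variance[OF elim]
          by (intro abs_expectation_le_sqrt integrable_square_deviation) auto
        finally show ?case by simp
      qed
      moreover have "(\<lambda>N. sqrt (v N) + \<bar>lam N / N - l\<bar>) \<longlonglongrightarrow> sqrt 0 + \<bar>l - l\<bar>"
        by (intro tendsto_intros v load)
      ultimately show ?thesis
        by (intro tendsto_sandwich[of "\<lambda>_. 0" "?e i"]) auto
    next
      case 3
      have "\<forall>\<^sub>F N in sequentially. ?e i N \<le> c ^ d N + v N / (c - r)\<^sup>2" using good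
      proof eventually_elim
        case (elim N)
        then interpret stationary_jsq N b "d N" "tie N" "lam N" "M N" "X N" "\<rho> N" by simp
        have "?e i N \<le> measure_pmf.expectation (\<rho> N) (\<lambda>z. z 2)"
        proof (rule integral_mono_AE)
          show "AE z in \<rho> N. \<bar>z i - q_star l i\<bar> \<le> z 2"
            using 3 support_bounds(1)[of _ i] support_bounds(4)[of _ 2 i] by (intro AE_pmfI) (auto simp: q_star_def)
        qed (use integrable_coordinate in auto)
        also have "\<dots> \<le> lam N / N * measure_pmf.expectation (\<rho> N) (\<lambda>z. z 1 ^ d N)"
          using expectation_Suc_le[of 1] by (simp add: numeral_2_eq_2)
        also have "\<dots> \<le> 1 * measure_pmf.expectation (\<rho> N) (\<lambda>z. z 1 ^ d N)"
        proof (rule mult_right_mono)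
          show "0 \<le> measure_pmf.expectation (\<rho> N) (\<lambda>z. z 1 ^ d N)"
            using support_bounds(1) by (intro integral_nonneg_AE AE_pmfI) auto
        qed (use elim r in linarith)
        also have "\<dots> \<le> c ^ d N + measure_pmf.expectation (\<rho> N) (\<lambda>z. (z 1 - lam N / N)\<^sup>2) / (c - r)\<^sup>2"
          using expectation_busy_power_le[of r c] elim r by simp
        also have "\<dots> \<le> c ^ d N + v N / (c - r)\<^sup>2"
          using variance[OF elim] by (intro add_left_mono divide_right_mono) auto
        finally show ?case .
      qed
      moreover have "(\<lambda>N. c ^ d N + v N / (c - r)\<^sup>2) \<longlonglongrightarrow> 0 + 0 / (c - r)\<^sup>2"
        using r by (intro tendsto_intros v c_pow) auto
      ultimately show ?thesis
        by (intro tendsto_sandwich[of "\<lambda>_. 0" "?e i"]) auto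
    qed
  qed
  have dom: "\<forall>\<^sub>F N in sequentially. \<forall>i. norm (?e i N) \<le> r ^ i + q_star l i" using good
  proof eventually_elim
    case (elim N)
    then interpret stationary_jsq N b "d N" "tie N" "lam N" "M N" "X N" "\<rho> N" by simp
    have "?e i N \<le> r ^ i + q_star l i" for i
    proof -
      have "?e i N \<le> measure_pmf.expectation (\<rho> N) (\<lambda>z. z i + q_star l i)"
      proof (rule integral_mono_AE)
        show "AE z in \<rho> N. \<bar>z i - q_star l i\<bar> \<le> z i + q_star l i"
          using support_bounds(1)[of _ i] l01 by (intro AE_pmfI) (auto simp: q_star_def abs_le_iff)
      qed (use integrable_coordinate in auto)
      also have "\<dots> = measure_pmf.expectation (\<rho> N) (\<lambda>z. z i) + q_star l i"
        using integrable_coordinate by simp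
      also have "measure_pmf.expectation (\<rho> N) (\<lambda>z. z i) \<le> r ^ i"
      proof (cases "i = 0")
        case True
        have "measure_pmf.expectation (\<rho> N) (\<lambda>z. z i) \<le> 1"
          using support_bounds(2)[of _ i]
          by (intro measure_pmf.integral_le_const integrable_coordinate AE_pmfI) auto
        then show ?thesis using True by simp
      next
        case False
        then have "measure_pmf.expectation (\<rho> N) (\<lambda>z. z i) \<le> (lam N / N) ^ i"
          by (intro expectation_le_power) auto
        also have "\<dots> \<le> r ^ i" using elim by (intro power_mono) auto
        finally show ?thesis .
      qed
      finally show ?thesis by simp
    qed
    then show ?case by simp
  qed
  have "summable (q_star l)"
    by (rule summable_finite[of "{1}"]) (auto simp: q_star_def)
  then have sm: "summable (\<lambda>i. r ^ i + q_star l i)"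
    using r by (intro summable_add summable_geometric) auto
  have "\<forall>\<^sub>F (i, N) in at_top \<times>\<^sub>F sequentially. norm (?e i N) \<le> r ^ i + q_star l i"
    using eventually_prodI[OF eventually_True dom] by (rule eventually_mono) auto
  from tannerys_theorem[OF lim this sm]
  show "\<forall>\<^sub>F N in sequentially. summable (\<lambda>i. ?e i N)" and "(\<lambda>N. \<Sum>i. ?e i N) \<longlonglongrightarrow> 0"
    by (auto elim: eventually_mono)
qed

theorem proposition2p2:
  fixes b :: enat
    and d :: "nat \<Rightarrow> nat"
    and lam :: "nat \<Rightarrow> real"
    and l :: real
    and tie :: "nat \<Rightarrow> nat list \<Rightarrow> nat set \<Rightarrow> nat pmf"
    and M :: "nat \<Rightarrow> 'w measure"
    and X :: "nat \<Rightarrow> real \<Rightarrow> 'w \<Rightarrow> nat list"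
    and \<pi> :: "nat \<Rightarrow> (nat \<Rightarrow> real) measure"
  assumes "1 \<le> b"
    and "\<And>N. N \<ge> 1 \<Longrightarrow> 1 \<le> d N \<and> d N \<le> N"
    and "\<And>N. N \<ge> 1 \<Longrightarrow> 0 \<le> lam N"
    and "\<And>N. N \<ge> 1 \<Longrightarrow> jsq_system N b (d N) (tie N) (lam N) (M N) (X N)"
    and "(\<lambda>N. lam N / real N) \<longlonglongrightarrow> l" and "l < 1"
    and "\<forall>\<^sub>F N in sequentially. is_stationary_measure N b (M N) (X N) (\<pi> N)"
    and "filterlim d at_top sequentially"
  shows "weakly_converges (occ_topology b) \<pi> (return (borel_on (occ_topology b)) (q_star l))"
proof -
  have l0: "0 \<le> l"
  proof (rule LIMSEQ_le_const[OF assms(5)])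
    show "\<exists>n. \<forall>N\<ge>n. 0 \<le> lam N / real N" using assms(3) by (intro exI[of _ 1]) auto
  qed
  have p: "q_star l \<in> occ_space b"
    using assms(1,6) l0 by (intro q_star_in_occ_space) auto
  let ?law = "\<lambda>N \<rho>. (\<forall>z. ((\<lambda>t. measure (M N) {\<omega>\<in>space (M N). occupancy N b (X N t \<omega>) = z}) \<longlongrightarrow> pmf \<rho> z) at_top) \<and>
    (\<forall>f. f \<in> borel_measurable (borel_on (occ_topology b)) \<longrightarrow>
       integral\<^sup>L (\<pi> N) f = measure_pmf.expectation \<rho> (f :: _ \<Rightarrow> real))"
  have "\<exists>\<rho>. ?law N \<rho>" if N: "N \<ge> 1" and stat: "is_stationary_measure N b (M N) (X N) (\<pi> N)" for N
    using stat
  proof (rule stationary_measure_pmf)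
    fix t \<omega> assume "0 \<le> (t::real)" "\<omega> \<in> space (M N)"
    moreover from this have "X N t \<in> measurable (M N) (count_space (queue_states N b))"
      using assms(4)[OF N] unfolding jsq_system_def is_ctmc_def by blast
    ultimately show "X N t \<omega> \<in> queue_states N b" by (simp add: measurable_def Pi_iff)
  qed
  then have "\<forall>N. \<exists>\<rho>. N \<ge> 1 \<longrightarrow> is_stationary_measure N b (M N) (X N) (\<pi> N) \<longrightarrow> ?law N \<rho>" by blast
  from choice[OF this] obtain \<rho>
    where "\<forall>N. N \<ge> 1 \<longrightarrow> is_stationary_measure N b (M N) (X N) (\<pi> N) \<longrightarrow> ?law N (\<rho> N)" ..
  then have \<rho>: "?law N (\<rho> N)" if "N \<ge> 1" "is_stationary_measure N b (M N) (X N) (\<pi> N)" for N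
    using that by blast
  have stat: "\<forall>\<^sub>F N in sequentially. stationary_jsq N b (d N) (tie N) (lam N) (M N) (X N) (\<rho> N)"
    using assms(7) eventually_ge_at_top[of 1]
  proof eventually_elim
    case (elim N)
    then show ?case using assms(1) assms(2-4)[of N] \<rho>[OF elim(2,1)] by unfold_locales auto
  qed
  show ?thesis
  proof (rule weakly_converges_occ_dirac[OF p, of \<rho>])
    show "\<forall>\<^sub>F N in sequentially. set_pmf (\<rho> N) \<subseteq> occ_space b \<and>
      (\<forall>f. f \<in> borel_measurable (borel_on (occ_topology b)) \<longrightarrow>
        integral\<^sup>L (\<pi> N) f = measure_pmf.expectation (\<rho> N) (f :: _ \<Rightarrow> real))"
      using assms(7) eventually_ge_at_top[of 1] stat
    proof eventually_elim
      case (elim N)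
      then have "set_pmf (\<rho> N) \<subseteq> occ_space b"
        using stationary_jsq.support occupancy_in_occ_space by fastforce
      with \<rho>[OF elim(2,1)] show ?case by blast
    qed
  next
    fix \<delta> :: real assume \<delta>: "0 < \<delta>"
    let ?dev = "\<lambda>N. \<Sum>i. measure_pmf.expectation (\<rho> N) (\<lambda>z. \<bar>z i - q_star l i\<bar>)"
    note dev = stationary_deviation_tendsto_0[OF l0 assms(6,5,8) stat]
    have "\<forall>\<^sub>F N in sequentially. measure (\<rho> N) {z. \<delta> \<le> l1_dist z (q_star l)} \<le> ?dev N / \<delta>"
      using stat dev(1)
    proof eventually_elim
      case (elim N)
      show ?case by (rule stationary_jsq.prob_l1_dist_ge_le[OF elim(1) p \<delta> elim(2)])
    qed
    moreover have "(\<lambda>N. ?dev N / \<delta>) \<longlonglongrightarrow> 0 / \<delta>"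
      using \<delta> by (intro tendsto_divide dev(2)) auto
    ultimately show "(\<lambda>N. measure (\<rho> N) {z. \<delta> \<le> l1_dist z (q_star l)}) \<longlonglongrightarrow> 0"
      by (intro tendsto_sandwich[of "\<lambda>_. 0" "\<lambda>N. measure (\<rho> N) {z. \<delta> \<le> l1_dist z (q_star l)}"]) auto
  qed
qed

end
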